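(* Let $G$ be a finite simple graph. If $J(G)^{(k)}$ and $J(G)^{(k+1)}$ are both not componentwise linear for some $k\ge 1$, then for every $k'\ge k$ the ideal $J(G)^{(k')}$ is not componentwise linear.
   Context: Let $V(G)=\{x_1,\dots,x_n\}$ and $R=\mathbb{K}[x_1,\dots,x_n]$, $\mathbb{K}$ a field. The cover ideal is $J(G)=\bigcap_{\{x_i,x_j\}\in E(G)}(x_i,x_j)$, and its $k$-th symbolic power is $J(G)^{(k)}=\bigcap_{\{x_i,x_j\}\in E(G)}(x_i,x_j)^k$. A homogeneous ideal $I$ is componentwise linear if for each $\ell$ the ideal generated by all degree $\ell$ elements of $I$ has a linear resolution. *)

theory Defs
  imports Complex_Main "HOL-Library.Poly_Mapping"
begin

section \<open>Polynomials and ideals\<close>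

text \<open>
  The polynomial ring over \<open>'k\<close> whose variables are indexed by \<open>'v\<close>: finitely supported
  functions from exponent vectors to coefficients, multiplied by convolution.
\<close>

type_synonym ('v, 'k) mpoly = "('v \<Rightarrow>\<^sub>0 nat) \<Rightarrow>\<^sub>0 'k"

definition var :: "'v \<Rightarrow> ('v, 'k::comm_ring_1) mpoly"
  where "var v = Poly_Mapping.single (Poly_Mapping.single v 1) 1"

definition total_degree :: "('v \<Rightarrow>\<^sub>0 nat) \<Rightarrow> nat"
  where "total_degree m = (\<Sum>v \<in> Poly_Mapping.keys m. Poly_Mapping.lookup m v)"

text \<open>The zero polynomial is homogeneous of every degree.\<close>

definition homogeneous :: "nat \<Rightarrow> ('v, 'k::comm_ring_1) mpoly \<Rightarrow> bool"
  where "homogeneous d p \<longleftrightarrow> (\<forall>m \<in> Poly_Mapping.keys p. total_degree m = d)"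

text \<open>The ideal generated by a set is its span in the ring, viewed as a module over itself.\<close>

abbreviation ideal_gen :: "'a::comm_ring_1 set \<Rightarrow> 'a set"
  where "ideal_gen \<equiv> module.span (*)"

definition ideal_mult :: "'a::comm_ring_1 set \<Rightarrow> 'a set \<Rightarrow> 'a set"
  where "ideal_mult I J = ideal_gen {a * b | a b. a \<in> I \<and> b \<in> J}"

primrec ideal_power :: "'a::comm_ring_1 set \<Rightarrow> nat \<Rightarrow> 'a set"
  where
    "ideal_power I 0 = UNIV"
  | "ideal_power I (Suc k) = ideal_mult I (ideal_power I k)"


section \<open>Graded free resolutions\<close>

text \<open>
  The free module of rank \<open>n\<close>, encoded as the sequences vanishing from index \<open>n\<close> on.
\<close>

definition free_module :: "nat \<Rightarrow> (nat \<Rightarrow> 'a::comm_ring_1) set"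
  where "free_module n = {x. \<forall>j \<ge> n. x j = 0}"

definition mat_map :: "nat \<Rightarrow> nat \<Rightarrow> (nat \<Rightarrow> nat \<Rightarrow> 'a::comm_ring_1) \<Rightarrow> (nat \<Rightarrow> 'a) \<Rightarrow> (nat \<Rightarrow> 'a)"
  where "mat_map m n A x = (\<lambda>r. if r < m then \<Sum>c<n. A r c * x c else 0)"

text \<open>
  A graded free resolution \<open>\<dots> \<rightarrow> F\<^sub>2 \<rightarrow> F\<^sub>1 \<rightarrow> F\<^sub>0 \<rightarrow> I \<rightarrow> 0\<close> of an ideal \<open>I\<close>, where \<open>F\<^sub>i\<close> is the direct sum
  of the modules \<open>R(-s\<^sub>i\<^sub>j)\<close> over \<open>j < b\<^sub>i\<close>,
  given by the ranks \<open>b i\<close>, the shifts \<open>s i j\<close>, the images \<open>g j\<close> of the basis of \<open>F\<^sub>0\<close>, and the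
  matrices \<open>D i\<close> of the differentials from \<open>F\<^sub>i\<^sub>+\<^sub>1\<close> to \<open>F\<^sub>i\<close>.  The first two conditions say that
  the maps preserve degrees, the other three that the sequence is exact.
\<close>

definition graded_free_resolution ::
  "('v, 'k::field) mpoly set \<Rightarrow> (nat \<Rightarrow> nat) \<Rightarrow> (nat \<Rightarrow> nat \<Rightarrow> nat) \<Rightarrow>
    (nat \<Rightarrow> ('v, 'k) mpoly) \<Rightarrow> (nat \<Rightarrow> nat \<Rightarrow> nat \<Rightarrow> ('v, 'k) mpoly) \<Rightarrow> bool"
  where "graded_free_resolution I b s g D \<longleftrightarrow>
    (\<forall>j < b 0. homogeneous (s 0 j) (g j)) \<and>
    (\<forall>i. \<forall>r < b i. \<forall>c < b (Suc i).
       \<forall>m \<in> Poly_Mapping.keys (D i r c). s i r + total_degree m = s (Suc i) c) \<and>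
    (\<lambda>x. \<Sum>j<b 0. g j * x j) ` free_module (b 0) = I \<and>
    mat_map (b 0) (b 1) (D 0) ` free_module (b 1) =
      {x \<in> free_module (b 0). (\<Sum>j<b 0. g j * x j) = 0} \<and>
    (\<forall>i. mat_map (b (Suc i)) (b (Suc (Suc i))) (D (Suc i)) ` free_module (b (Suc (Suc i))) =
      {x \<in> free_module (b (Suc i)). mat_map (b i) (b (Suc i)) (D i) x = (\<lambda>_. 0)})"

text \<open>
  Minimality: every differential maps \<open>F\<^sub>i\<^sub>+\<^sub>1\<close> into the multiple of \<open>F\<^sub>i\<close> by the ideal generated
  by the variables, that is, the matrix entries have zero constant term.
\<close>

definition minimal_graded_free_resolution ::
  "('v, 'k::field) mpoly set \<Rightarrow> (nat \<Rightarrow> nat) \<Rightarrow> (nat \<Rightarrow> nat \<Rightarrow> nat) \<Rightarrow>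
    (nat \<Rightarrow> ('v, 'k) mpoly) \<Rightarrow> (nat \<Rightarrow> nat \<Rightarrow> nat \<Rightarrow> ('v, 'k) mpoly) \<Rightarrow> bool"
  where "minimal_graded_free_resolution I b s g D \<longleftrightarrow>
    graded_free_resolution I b s g D \<and>
    (\<forall>i. \<forall>r < b i. \<forall>c < b (Suc i). Poly_Mapping.lookup (D i r c) 0 = 0)"

text \<open>
  The minimal resolution has \<open>F\<^sub>i\<close> free on generators of degree \<open>d + i\<close>, for one fixed \<open>d\<close>.
  The zero ideal has a linear resolution (all ranks are zero).
\<close>

definition has_linear_resolution :: "('v, 'k::field) mpoly set \<Rightarrow> bool"
  where "has_linear_resolution I \<longleftrightarrow>
    (\<exists>d b s g D. minimal_graded_free_resolution I b s g D \<and>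
      (\<forall>i. \<forall>j < b i. s i j = d + i))"

definition degree_component_ideal :: "('v, 'k::field) mpoly set \<Rightarrow> nat \<Rightarrow> ('v, 'k) mpoly set"
  where "degree_component_ideal I l = ideal_gen {f \<in> I. homogeneous l f}"

text \<open>Only meaningful for homogeneous ideals \<open>I\<close>.\<close>

definition componentwise_linear :: "('v, 'k::field) mpoly set \<Rightarrow> bool"
  where "componentwise_linear I \<longleftrightarrow> (\<forall>l. has_linear_resolution (degree_component_ideal I l))"


section \<open>Cover ideals\<close>

text \<open>
  Finite simple graphs are given by their edge sets; the vertex set is the whole type \<open>'v\<close>,
  which is also the index set of the variables.
\<close>

definition simple_graph :: "'v::finite set set \<Rightarrow> bool"
  where "simple_graph E \<longleftrightarrow> (\<forall>e \<in> E. \<exists>u v. u \<noteq> v \<and> e = {u, v})"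

definition edge_prime :: "'v set \<Rightarrow> ('v, 'k::field) mpoly set"
  where "edge_prime e = ideal_gen (var ` e)"

text \<open>For a graph without edges the intersections below are the whole ring.\<close>

definition cover_ideal :: "'v::finite set set \<Rightarrow> ('v, 'k::field) mpoly set"
  where "cover_ideal E = (\<Inter>e \<in> E. edge_prime e)"

definition cover_ideal_symbolic_power :: "'v::finite set set \<Rightarrow> nat \<Rightarrow> ('v, 'k::field) mpoly set"
  where "cover_ideal_symbolic_power E k = (\<Inter>e \<in> E. ideal_power (edge_prime e) k)"

lemma module_mult: "module ((*) :: 'a::comm_ring_1 \<Rightarrow> 'a \<Rightarrow> 'a)"
  by unfold_locales (simp_all add: algebra_simps)

lemma ideal_power_1: "ideal_power (ideal_gen S) 1 = ideal_gen S"
proof -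
  interpret module "(*) :: 'a::comm_ring_1 \<Rightarrow> 'a \<Rightarrow> 'a" by (rule module_mult)
  have "{a * b | a b. a \<in> span S \<and> b \<in> UNIV} = span S"
  proof (intro equalityI subsetI)
    fix x assume "x \<in> {a * b | a b. a \<in> span S \<and> b \<in> UNIV}"
    then obtain a b where "x = b * a" "a \<in> span S" by (auto simp: mult.commute)
    then show "x \<in> span S" by (simp only: span_scale)
  next
    fix x assume "x \<in> span S"
    then have "x = x * 1 \<and> x \<in> span S \<and> (1 :: 'a) \<in> UNIV" by simp
    then show "x \<in> {a * b | a b. a \<in> span S \<and> b \<in> UNIV}" by blast
  qed
  then show ?thesis by (simp add: ideal_mult_def span_span)
qed

lemma cover_ideal_symbolic_power_1: "cover_ideal_symbolic_power E 1 = cover_ideal E"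
  by (simp only: cover_ideal_symbolic_power_def cover_ideal_def edge_prime_def ideal_power_1)

end

theory Submission
  imports Defs "HOL-Library.Function_Algebras"
begin

text \<open>
  It suffices that \<open>J(k + 2)\<close> componentwise linear implies \<open>J(k)\<close> componentwise linear, where \<open>J(k)\<close> is
  the \<open>k\<close>-th symbolic power.  An ideal generated in degree \<open>l\<close> has a linear resolution iff its Koszul
  homology is concentrated on the linear strand: in one direction lift Koszul cycles through the
  resolution, in the other build the resolution step by step, the kernel of a minimal cover
  inheriting the vanishing.  For monomial ideals this homology splits into multidegrees.  Let \<open>s\<close> be
  the product of the non-isolated vertices.  A monomial \<open>m\<close> lies in \<open>J(k)\<close> iff \<open>s m\<close> lies in \<open>J(k + 2)\<close>,
  and every monomial of \<open>J(k + 2)\<close> with exponents at most \<open>k + 1\<close> is a multiple of \<open>s\<close>.  So, up to the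
  shift by \<open>s\<close>, the Koszul homology of the two ideals agrees in the multidegrees that are at most \<open>k\<close>
  everywhere and \<open>0\<close> at isolated vertices.  In every other multidegree the complex of \<open>J(k)\<close> is a cone,
  because \<open>J(k)\<close> is generated by monomials with exponents within these bounds.
\<close>

section \<open>Exponents and homogeneous components\<close>

lemma total_degree_eq_sum: "total_degree (m :: 'v::finite \<Rightarrow>\<^sub>0 nat) = (\<Sum>v\<in>UNIV. Poly_Mapping.lookup m v)"
  unfolding total_degree_def by (rule sum.mono_neutral_left) (auto simp: in_keys_iff)

lemma total_degree_add: "total_degree (m + n :: 'v::finite \<Rightarrow>\<^sub>0 nat) = total_degree m + total_degree n"
  by (simp add: total_degree_eq_sum lookup_add sum.distrib)

lemma total_degree_zero [simp]: "total_degree 0 = 0"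
  by (simp add: total_degree_def)

lemma total_degree_single: "total_degree (Poly_Mapping.single v a) = a"
  by (simp add: total_degree_def)

lemma total_degree_eq_0_iff: "total_degree (m :: 'v::finite \<Rightarrow>\<^sub>0 nat) = 0 \<longleftrightarrow> m = 0"
  by (auto simp: total_degree_eq_sum intro!: poly_mapping_eqI)

text \<open>Each exponent is at most \<open>e\<close> and there are finitely many variables. This
  finiteness lets multidegree parts be summed back into one polynomial and makes graded pieces
  finite-dimensional.\<close>

lemma finite_total_degree: "finite {m :: 'v::finite \<Rightarrow>\<^sub>0 nat. total_degree m = e}"
proof (rule inj_on_finite[where f = Poly_Mapping.lookup])
  show "inj_on Poly_Mapping.lookup {m :: 'v \<Rightarrow>\<^sub>0 nat. total_degree m = e}"
    by (simp add: inj_on_def lookup_inject)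
  have "Poly_Mapping.lookup m v \<le> e" if "total_degree m = e" for m :: "'v \<Rightarrow>\<^sub>0 nat" and v
    using that member_le_sum[of v UNIV "Poly_Mapping.lookup m"] by (simp add: total_degree_eq_sum)
  then show "Poly_Mapping.lookup ` {m :: 'v \<Rightarrow>\<^sub>0 nat. total_degree m = e} \<subseteq>
      {f. \<forall>v. (v \<in> UNIV \<longrightarrow> f v \<in> {..e}) \<and> (v \<notin> UNIV \<longrightarrow> f v = 0)}"
    by auto
  show "finite {f. \<forall>v :: 'v. (v \<in> UNIV \<longrightarrow> f v \<in> {..e}) \<and> (v \<notin> UNIV \<longrightarrow> f v = (0 :: nat))}"
    by (rule finite_set_of_finite_funs) auto
qed

text \<open>Divisibility of monomials, expressed on exponents.\<close>

definition exp_le :: "('v \<Rightarrow>\<^sub>0 nat) \<Rightarrow> ('v \<Rightarrow>\<^sub>0 nat) \<Rightarrow> bool"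
  where "exp_le u m \<longleftrightarrow> (\<forall>v. Poly_Mapping.lookup u v \<le> Poly_Mapping.lookup m v)"

definition indicator_exp :: "'v::finite set \<Rightarrow> 'v \<Rightarrow>\<^sub>0 nat"
  where "indicator_exp A = Abs_poly_mapping (\<lambda>v. if v \<in> A then 1 else 0)"

lemma lookup_Abs_finite: "Poly_Mapping.lookup (Abs_poly_mapping f) (v :: 'v::finite) = f v"
  by (simp add: lookup_Abs_poly_mapping)

lemma lookup_indicator_exp: "Poly_Mapping.lookup (indicator_exp A) v = (if v \<in> A then 1 else 0)"
  by (simp add: indicator_exp_def lookup_Abs_finite)

lemma exp_le_indicator_exp: "exp_le (indicator_exp A) b \<longleftrightarrow> (\<forall>v\<in>A. Poly_Mapping.lookup b v > 0)"
  by (auto simp: exp_le_def lookup_indicator_exp Suc_le_eq split: if_splits)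

lemma total_degree_indicator_exp: "total_degree (indicator_exp A) = card A"
  by (simp add: total_degree_eq_sum lookup_indicator_exp sum.If_cases)

lemma exp_le_add_diff: "exp_le u m \<Longrightarrow> m - u + u = m"
  by (rule poly_mapping_eqI) (simp add: lookup_add lookup_minus exp_le_def)

lemma exp_le_add_self: "exp_le u (m + u)" "exp_le u (u + m)"
  by (simp_all add: exp_le_def lookup_add)

lemma exp_le_trans: "exp_le u m \<Longrightarrow> exp_le m w \<Longrightarrow> exp_le u w"
  unfolding exp_le_def using le_trans by blast

lemma exp_le_refl [simp]: "exp_le u u"
  by (simp add: exp_le_def)

lemma total_degree_mono: "exp_le u m \<Longrightarrow> total_degree u \<le> total_degree (m :: 'v::finite \<Rightarrow>\<^sub>0 nat)"
  by (simp add: total_degree_eq_sum exp_le_def sum_mono)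

lemma total_degree_diff:
  "exp_le u m \<Longrightarrow> total_degree (m - u) = total_degree m - total_degree (u :: 'v::finite \<Rightarrow>\<^sub>0 nat)"
  by (metis exp_le_add_diff total_degree_add add_diff_cancel_right')

text \<open>Between two monomials, one dividing the other, the degree can be raised one variable at
  a time, so every intermediate degree is reached.\<close>

lemma exp_interpolate:
  fixes u m :: "'v::finite \<Rightarrow>\<^sub>0 nat"
  assumes "exp_le u m" "total_degree u \<le> l" "l \<le> total_degree m"
  obtains w where "exp_le u w" "exp_le w m" "total_degree w = l"
proof -
  have "\<exists>w. exp_le u w \<and> exp_le w m \<and> total_degree w = l"
    using assms(2,3)
  proof (induction l)
    case 0
    with assms(1) show ?case by (intro exI[of _ u]) simp
  next
    case (Suc l)
    show ?case
    proof (cases "total_degree u = Suc l")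
      case True
      with assms(1) show ?thesis by (intro exI[of _ u]) simp
    next
      case False
      with Suc obtain w where w: "exp_le u w" "exp_le w m" "total_degree w = l" by auto
      have "\<exists>v. Poly_Mapping.lookup w v < Poly_Mapping.lookup m v"
      proof (rule ccontr)
        assume "\<not> ?thesis"
        then have "exp_le m w" by (simp add: exp_le_def not_less)
        with total_degree_mono[OF this] w(3) Suc.prems show False by simp
      qed
      then obtain v where v: "Poly_Mapping.lookup w v < Poly_Mapping.lookup m v" ..
      have "exp_le (w + Poly_Mapping.single v 1) m"
        using v w(2) by (auto simp: exp_le_def lookup_add lookup_single when_def)
      moreover have "total_degree (w + Poly_Mapping.single v 1) = Suc l"
        using w(3) by (simp add: total_degree_add total_degree_single)
      moreover have "exp_le u (w + Poly_Mapping.single v 1)"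
        by (rule exp_le_trans[OF w(1) exp_le_add_self(2)])
      ultimately show ?thesis by blast
    qed
  qed
  with that show thesis by blast
qed

section \<open>Homogeneous components of polynomials\<close>

definition hcomp :: "nat \<Rightarrow> ('v, 'k::comm_ring_1) mpoly \<Rightarrow> ('v, 'k) mpoly"
  where "hcomp e p = (\<Sum>m \<in> {m \<in> Poly_Mapping.keys p. total_degree m = e}.
    Poly_Mapping.single m (Poly_Mapping.lookup p m))"

lemma lookup_hcomp:
  "Poly_Mapping.lookup (hcomp e p) m = (if total_degree m = e then Poly_Mapping.lookup p m else 0)"
  by (auto simp: hcomp_def lookup_sum lookup_single when_def in_keys_iff sum.delta')

lemma homogeneous_iff:
  "homogeneous d p \<longleftrightarrow> (\<forall>m. Poly_Mapping.lookup p m \<noteq> 0 \<longrightarrow> total_degree m = d)"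
  by (auto simp: homogeneous_def in_keys_iff)

lemma homogeneous_hcomp: "homogeneous e (hcomp e p)"
  by (simp add: homogeneous_iff lookup_hcomp)

lemma hcomp_homogeneous: "homogeneous d p \<Longrightarrow> hcomp e p = (if e = d then p else 0)"
  by (rule poly_mapping_eqI) (auto simp: homogeneous_iff lookup_hcomp)

lemma hcomp_same: "homogeneous d p \<Longrightarrow> hcomp d p = p"
  by (simp add: hcomp_homogeneous)

lemma hcomp_add: "hcomp e (p + q) = hcomp e p + hcomp e q"
  by (rule poly_mapping_eqI) (simp add: lookup_hcomp lookup_add)

lemma hcomp_zero [simp]: "hcomp e 0 = 0"
  by (rule poly_mapping_eqI) (simp add: lookup_hcomp)

lemma hcomp_sum: "hcomp e (sum f A) = (\<Sum>a\<in>A. hcomp e (f a))"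
  by (induction A rule: infinite_finite_induct) (simp_all add: hcomp_add)

lemma sum_hcomp:
  assumes "finite F" "total_degree ` Poly_Mapping.keys p \<subseteq> F"
  shows "(\<Sum>e\<in>F. hcomp e p) = p"
proof (rule poly_mapping_eqI)
  fix m
  have "total_degree m \<notin> F \<Longrightarrow> Poly_Mapping.lookup p m = 0"
    using assms(2) by (meson image_subset_iff in_keys_iff)
  with assms(1) show "Poly_Mapping.lookup (\<Sum>e\<in>F. hcomp e p) m = Poly_Mapping.lookup p m"
    by (auto simp: lookup_sum lookup_hcomp)
qed

lemma homogeneous_zero [simp]: "homogeneous d 0"
  by (simp add: homogeneous_def)

lemma homogeneous_add: "homogeneous d p \<Longrightarrow> homogeneous d q \<Longrightarrow> homogeneous d (p + q)"
  by (auto simp: homogeneous_iff lookup_add) (metis add.right_neutral)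

lemma homogeneous_diff: "homogeneous d p \<Longrightarrow> homogeneous d q \<Longrightarrow> homogeneous d (p - q)"
  by (auto simp: homogeneous_iff lookup_minus) (metis diff_0_right)

lemma homogeneous_sum: "(\<And>a. a \<in> A \<Longrightarrow> homogeneous d (f a)) \<Longrightarrow> homogeneous d (sum f A)"
  by (induction A rule: infinite_finite_induct) (simp_all add: homogeneous_add)

lemma homogeneous_mult:
  fixes p q :: "('v::finite, 'k::comm_ring_1) mpoly"
  assumes "homogeneous d p" "homogeneous e q"
  shows "homogeneous (d + e) (p * q)"
  using keys_mult[of p q] assms by (auto simp: homogeneous_def total_degree_add dest!: subsetD)

lemma homogeneous_var: "homogeneous 1 (var v)"
  by (auto simp: homogeneous_def var_def total_degree_single split: if_splits)

lemma homogeneous_single: "homogeneous (total_degree m) (Poly_Mapping.single m a)"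
  by (simp add: homogeneous_def)

lemma homogeneous_sign: "homogeneous d p \<Longrightarrow> homogeneous d ((-1) ^ n * p)"
  by (cases "even n") (simp_all add: homogeneous_iff)

lemma hcomp_mult:
  fixes a p :: "('v::finite, 'k::comm_ring_1) mpoly"
  assumes "homogeneous d a"
  shows "hcomp (d + e) (a * p) = a * hcomp e p"
proof -
  \<comment> \<open>The index \<open>e\<close> is inserted so that the sum over \<open>F\<close>
    contains it even when \<open>p\<close> has no term of degree \<open>e\<close>.\<close>
  define F where "F = insert e (total_degree ` Poly_Mapping.keys p)"
  have F: "finite F" "e \<in> F" by (auto simp: F_def)
  have "hcomp (d + e) (a * p) = hcomp (d + e) (a * (\<Sum>f\<in>F. hcomp f p))"
    by (subst sum_hcomp) (auto simp: F_def)
  also have "\<dots> = (\<Sum>f\<in>F. hcomp (d + e) (a * hcomp f p))"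
    by (simp add: sum_distrib_left hcomp_sum)
  also have "\<dots> = (\<Sum>f\<in>F. if f = e then a * hcomp e p else 0)"
    by (rule sum.cong)
      (auto simp: hcomp_homogeneous[OF homogeneous_mult[OF assms homogeneous_hcomp]])
  also have "\<dots> = a * hcomp e p"
    using F by simp
  finally show ?thesis .
qed

lemma homogeneous_0_const:
  fixes p :: "('v::finite, 'k::comm_ring_1) mpoly"
  assumes "homogeneous 0 p"
  shows "p = Poly_Mapping.single 0 (Poly_Mapping.lookup p 0)"
  using assms by (intro poly_mapping_eqI)
    (auto simp: homogeneous_iff lookup_single when_def total_degree_eq_0_iff)

lemma lookup_single_mult_add:
  fixes p :: "('v::finite, 'k::comm_ring_1) mpoly"
  shows "Poly_Mapping.lookup (Poly_Mapping.single n a * p) (n + m) = a * Poly_Mapping.lookup p m"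
  by (simp add: lookup_mult lookup_single when_def if_distrib[of "\<lambda>x. x * _"] cong: if_cong)

section \<open>The Koszul complex\<close>

text \<open>An arbitrary total order on the vertices, needed only to fix the exterior algebra
  signs.\<close>

definition vertex_number :: "'v::finite \<Rightarrow> nat"
  where "vertex_number = (SOME f. inj f)"

lemma inj_vertex_number: "inj (vertex_number :: 'v::finite \<Rightarrow> nat)"
proof -
  have "\<exists>f :: 'v \<Rightarrow> nat. inj f"
    using finite_imp_inj_to_nat_seg[of "UNIV :: 'v set"] by auto
  then show ?thesis unfolding vertex_number_def by (rule someI_ex)
qed

lemma vertex_number_cases:
  "x \<noteq> y \<Longrightarrow> vertex_number x < vertex_number y \<or> vertex_number y < vertex_number (x :: 'v::finite)"
  using inj_vertex_number by (metis injD linorder_neqE_nat)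

text \<open>The sign picked up when \<open>x\<close> is moved from the front into its place among
  the ordered elements of \<open>A\<close>.\<close>

definition koszul_sign :: "'v::finite \<Rightarrow> 'v set \<Rightarrow> 'a::comm_ring_1"
  where "koszul_sign x A = (-1) ^ card {y \<in> A. vertex_number y < vertex_number x}"

lemma koszul_sign_square: "koszul_sign x A * koszul_sign x A = 1"
  by (simp add: koszul_sign_def flip: power_add mult_2)

lemma koszul_sign_insert:
  "y \<notin> A \<Longrightarrow> koszul_sign x (insert y A) =
    (if vertex_number y < vertex_number x then - koszul_sign x A else koszul_sign x A)"
proof -
  assume y: "y \<notin> A"
  have "{z \<in> insert y A. vertex_number z < vertex_number x} =
    (if vertex_number y < vertex_number x then insert y {z \<in> A. vertex_number z < vertex_number x}
     else {z \<in> A. vertex_number z < vertex_number x})" by auto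
  with y show ?thesis by (auto simp: koszul_sign_def)
qed

text \<open>Exactly one of \<open>x\<close> and \<open>y\<close> comes before the other, so exactly
  one of the two signs changes when the other vertex is inserted. This is the anticommutativity
  behind the square of the boundary being zero.\<close>

lemma koszul_sign_swap:
  assumes "x \<noteq> y" "x \<notin> A" "y \<notin> A"
  shows "koszul_sign x A * koszul_sign y (insert x A) = - (koszul_sign y A * koszul_sign x (insert y A))"
  using vertex_number_cases[OF assms(1)] assms(2,3)
  by (auto simp: koszul_sign_insert mult.commute)

section \<open>Simplicial chains and the cone homotopy\<close>

text \<open>A chain is stored by its coefficients, so the coefficient of the boundary at
  \<open>A\<close> collects the contributions of all faces with one more vertex. The empty face is
  included, as in reduced homology.\<close>

definition simplicial_boundary :: "('v::finite set \<Rightarrow> 'k::comm_ring_1) \<Rightarrow> 'v set \<Rightarrow> 'k"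
  where "simplicial_boundary C A = (\<Sum>x\<in>-A. koszul_sign x A * C (insert x A))"

definition cone :: "'v::finite \<Rightarrow> ('v set \<Rightarrow> 'k::comm_ring_1) \<Rightarrow> 'v set \<Rightarrow> 'k"
  where "cone x C A = (if x \<in> A then koszul_sign x (A - {x}) * C (A - {x}) else 0)"

text \<open>Coning is a contracting homotopy: the boundary of the cone plus the cone of the boundary
  is the identity, and the second summand vanishes on cycles. Whether the cone stays inside a given
  subcomplex is treated separately.\<close>

lemma simplicial_boundary_cone:
  fixes C :: "'v::finite set \<Rightarrow> 'k::comm_ring_1"
  assumes "simplicial_boundary C = 0"
  shows "simplicial_boundary (cone x C) = C"
proof
  fix A
  show "simplicial_boundary (cone x C) A = C A"
  proof (cases "x \<in> A")
    case False
    have "simplicial_boundary (cone x C) A =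
        (\<Sum>y\<in>-A. if y = x then koszul_sign x A * (koszul_sign x A * C A) else 0)"
      unfolding simplicial_boundary_def using False
      by (intro sum.cong) (auto simp: cone_def)
    also have "\<dots> = koszul_sign x A * koszul_sign x A * C A"
      using False by (simp add: mult.assoc)
    finally show ?thesis by (simp add: koszul_sign_square)
  next
    case True
    define B where "B = A - {x}"
    have B: "A = insert x B" "x \<notin> B" using True by (auto simp: B_def)
    have compl: "- B = insert x (- A)" "x \<notin> - A" using B by auto
    have "simplicial_boundary C B = 0" using assms by simp
    \<comment> \<open>The cycle condition at \<open>B\<close> isolates the term of \<open>x\<close>,
      expressing \<open>C A\<close> through the other faces that contain \<open>B\<close>.\<close>
    then have cyc: "koszul_sign x B * C A + (\<Sum>y\<in>-A. koszul_sign y B * C (insert y B)) = 0"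
      using compl B by (simp add: simplicial_boundary_def)
    have sgn: "koszul_sign y A * koszul_sign x (insert y B) = - (koszul_sign x B * koszul_sign y B :: 'k)"
      if "y \<notin> A" for y
    proof -
      have y: "y \<noteq> x" "y \<notin> B" using that B by auto
      show ?thesis
        using vertex_number_cases[OF y(1)] y B
        by (auto simp: B(1) koszul_sign_insert mult.commute)
    qed
    have "simplicial_boundary (cone x C) A =
        (\<Sum>y\<in>-A. koszul_sign y A * (koszul_sign x (insert y B) * C (insert y B)))"
      unfolding simplicial_boundary_def
    proof (rule sum.cong)
      fix y assume "y \<in> - A"
      then have "insert y A - {x} = insert y B" using B by auto
      then show "koszul_sign y A * cone x C (insert y A) =
          koszul_sign y A * (koszul_sign x (insert y B) * C (insert y B))"
        using True by (simp add: cone_def)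
    qed simp
    also have "\<dots> = (\<Sum>y\<in>-A. - koszul_sign x B * (koszul_sign y B * C (insert y B)))"
      by (rule sum.cong) (simp_all add: mult.assoc[symmetric] sgn)
    also have "\<dots> = - koszul_sign x B * (\<Sum>y\<in>-A. koszul_sign y B * C (insert y B))"
      by (simp only: sum_distrib_left)
    also have "\<dots> = - koszul_sign x B * - (koszul_sign x B * C A)"
      using cyc by (simp add: add_eq_0_iff2)
    also have "\<dots> = C A"
      by (simp add: mult.assoc[symmetric] koszul_sign_square)
    finally show ?thesis .
  qed
qed

section \<open>The Koszul differential with coefficients in a free module\<close>

definition koszul_boundary ::
  "('v::finite set \<Rightarrow> nat \<Rightarrow> ('v, 'k::comm_ring_1) mpoly) \<Rightarrow> 'v set \<Rightarrow> nat \<Rightarrow> ('v, 'k) mpoly"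
  where "koszul_boundary c A j = (\<Sum>x\<in>-A. koszul_sign x A * var x * c (insert x A) j)"

lemma koszul_boundary_boundary:
  fixes c :: "'v::finite set \<Rightarrow> nat \<Rightarrow> ('v, 'k::comm_ring_1) mpoly"
  shows "koszul_boundary (koszul_boundary c) = 0"
proof (intro ext)
  fix A :: "'v set" and j
  define f where "f = (\<lambda>(x, y). koszul_sign x A * koszul_sign y (insert x A) *
    (var x * var y * c (insert x (insert y A)) j))"
  \<comment> \<open>The double sum runs over ordered pairs of distinct vertices outside
    \<open>A\<close>. They are split by which vertex comes first; swapping exchanges the halves and
    flips the sign, so the two sums cancel.\<close>
  define P where "P = {(x, y). x \<notin> A \<and> y \<notin> A \<and> vertex_number x < vertex_number y}"
  define Q where "Q = {(x, y). x \<notin> A \<and> y \<notin> A \<and> vertex_number y < vertex_number x}"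
  have swap: "f (y, x) = - f (x, y)" if "(x, y) \<in> P" for x y
  proof -
    have "x \<noteq> y" "x \<notin> A" "y \<notin> A" using that by (auto simp: P_def)
    then have "koszul_sign x A * koszul_sign y (insert x A) =
        - (koszul_sign y A * koszul_sign x (insert y A) :: ('v, 'k) mpoly)"
      by (rule koszul_sign_swap)
    then show ?thesis
      by (simp add: f_def insert_commute mult.commute)
  qed
  have "koszul_boundary (koszul_boundary c) A j = (\<Sum>x\<in>-A. \<Sum>y\<in>-insert x A. f (x, y))"
    by (simp add: koszul_boundary_def f_def sum_distrib_left insert_commute algebra_simps)
  also have "\<dots> = sum f (SIGMA x:-A. -insert x A)"
    by (simp add: sum.Sigma)
  also have "(SIGMA x:-A. -insert x A) = P \<union> Q"
    using vertex_number_cases by (auto simp: P_def Q_def)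
  also have "sum f (P \<union> Q) = sum f P + sum f Q"
    by (rule sum.union_disjoint) (auto simp: P_def Q_def)
  also have "sum f Q = (\<Sum>(x, y)\<in>P. f (y, x))"
    by (rule sum.reindex_bij_witness[where i = prod.swap and j = prod.swap])
      (auto simp: P_def Q_def)
  also have "\<dots> = - sum f P"
    unfolding sum_negf[symmetric] by (rule sum.cong) (auto simp: swap)
  finally show "koszul_boundary (koszul_boundary c) A j = 0 A j" by simp
qed

lemma koszul_boundary_diff: "koszul_boundary (c - c') = koszul_boundary c - koszul_boundary c'"
  by (intro ext) (simp add: koszul_boundary_def right_diff_distrib sum_subtractf)

definition koszul_chains ::
  "nat \<Rightarrow> nat \<Rightarrow> (nat \<Rightarrow> ('v::finite, 'k::comm_ring_1) mpoly) set \<Rightarrow> ('v set \<Rightarrow> nat \<Rightarrow> ('v, 'k) mpoly) set"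
  where "koszul_chains i e M =
    {c. \<forall>A. (\<forall>j. homogeneous e (c A j)) \<and> c A \<in> M \<and> (card A \<noteq> i \<longrightarrow> c A = 0)}"

text \<open>
  Up to the degree bound this is the vanishing of the \<open>i\<close>-th Koszul homology of \<open>M\<close>; \<open>e\<close> is the
  degree of the coefficients, so that the internal degree of a class is \<open>e + i\<close>.
\<close>

definition koszul_vanishing :: "nat \<Rightarrow> nat \<Rightarrow> (nat \<Rightarrow> ('v::finite, 'k::comm_ring_1) mpoly) set \<Rightarrow> bool"
  where "koszul_vanishing i d M \<longleftrightarrow>
    (\<forall>e > d. \<forall>c \<in> koszul_chains i e M. koszul_boundary c = 0 \<longrightarrow>
      (\<exists>w \<in> koszul_chains (Suc i) (e - 1) M. koszul_boundary w = c))"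

section \<open>Monomial submodules and multidegrees\<close>

definition monomial_module :: "nat \<Rightarrow> ('v \<Rightarrow>\<^sub>0 nat) set \<Rightarrow> (nat \<Rightarrow> ('v, 'k::comm_ring_1) mpoly) set"
  where "monomial_module n S = {x \<in> free_module n. \<forall>j. Poly_Mapping.keys (x j) \<subseteq> S}"

text \<open>When \<open>S\<close> is the set of exponents of a monomial ideal, these are the chains
  of its upper Koszul simplicial complex in multidegree \<open>b\<close>; \<open>i\<close> counts
  vertices rather than dimension.\<close>

definition multigraded_chains ::
  "nat \<Rightarrow> ('v::finite \<Rightarrow>\<^sub>0 nat) \<Rightarrow> ('v \<Rightarrow>\<^sub>0 nat) set \<Rightarrow> ('v set \<Rightarrow> 'k::comm_ring_1) set"
  where "multigraded_chains i b S =
    {C. \<forall>A. C A \<noteq> 0 \<longrightarrow> card A = i \<and> exp_le (indicator_exp A) b \<and> b - indicator_exp A \<in> S}"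

text \<open>The guard is there because subtraction of exponents truncates at zero.\<close>

definition multidegree_part ::
  "('v::finite \<Rightarrow>\<^sub>0 nat) \<Rightarrow> ('v set \<Rightarrow> ('v, 'k::comm_ring_1) mpoly) \<Rightarrow> 'v set \<Rightarrow> 'k"
  where "multidegree_part b c A =
    (if exp_le (indicator_exp A) b then Poly_Mapping.lookup (c A) (b - indicator_exp A) else 0)"

lemma lookup_var_mult:
  fixes p :: "('v::finite, 'k::comm_ring_1) mpoly"
  shows "Poly_Mapping.lookup (var x * p) m =
    (if Poly_Mapping.lookup m x > 0 then Poly_Mapping.lookup p (m - Poly_Mapping.single x 1) else 0)"
proof (cases "Poly_Mapping.lookup m x > 0")
  case True
  then have "exp_le (Poly_Mapping.single x 1) m"
    by (auto simp: exp_le_def lookup_single when_def)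
  from exp_le_add_diff[OF this] have m: "Poly_Mapping.single x 1 + (m - Poly_Mapping.single x 1) = m"
    by (simp add: add.commute)
  have "Poly_Mapping.lookup (var x * p) (Poly_Mapping.single x 1 + (m - Poly_Mapping.single x 1)) =
      Poly_Mapping.lookup p (m - Poly_Mapping.single x 1)"
    unfolding var_def by (subst lookup_single_mult_add) simp
  with True show ?thesis unfolding m by simp
next
  case False
  have "m \<notin> Poly_Mapping.keys (var x * p)"
  proof
    assume "m \<in> Poly_Mapping.keys (var x * p)"
    with keys_mult[of "var x" p] obtain a b where "a \<in> Poly_Mapping.keys (var x :: ('v, 'k) mpoly)" "m = a + b"
      by blast
    with False show False by (auto simp: var_def lookup_add split: if_splits)
  qed
  with False show ?thesis by (simp add: in_keys_iff)
qed

text \<open>Give the basis element of \<open>A\<close> the multidegree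
  \<open>indicator_exp A\<close>. Then multiplying by a variable while removing that vertex
  preserves the multidegree, and on coefficients only the sign remains.\<close>

lemma multidegree_part_koszul_boundary:
  fixes c :: "'v::finite set \<Rightarrow> nat \<Rightarrow> ('v, 'k::comm_ring_1) mpoly"
  shows "multidegree_part b (\<lambda>A. koszul_boundary c A j) = simplicial_boundary (multidegree_part b (\<lambda>A. c A j))"
proof
  fix A :: "'v set"
  have le: "exp_le (indicator_exp (insert x A)) b \<longleftrightarrow>
      exp_le (indicator_exp A) b \<and> Poly_Mapping.lookup (b - indicator_exp A) x > 0"
    and eq: "b - indicator_exp (insert x A) = b - indicator_exp A - Poly_Mapping.single x 1"
    if "x \<notin> A" for x
  proof -
    have ind: "Poly_Mapping.lookup (indicator_exp (insert x A)) y =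
      Poly_Mapping.lookup (indicator_exp A) y + (if y = x then 1 else 0)" for y
      using that by (auto simp: lookup_indicator_exp)
    show "exp_le (indicator_exp (insert x A)) b \<longleftrightarrow>
      exp_le (indicator_exp A) b \<and> Poly_Mapping.lookup (b - indicator_exp A) x > 0"
      unfolding exp_le_def ind lookup_minus
      using that by (auto simp: lookup_indicator_exp)
    show "b - indicator_exp (insert x A) = b - indicator_exp A - Poly_Mapping.single x 1"
      by (rule poly_mapping_eqI) (auto simp: lookup_minus ind lookup_single when_def)
  qed
  have sgn: "Poly_Mapping.lookup (koszul_sign x A * p) m = koszul_sign x A * Poly_Mapping.lookup p m"
    for x m and p :: "('v, 'k) mpoly"
    by (cases "even (card {y \<in> A. vertex_number y < vertex_number x})") (simp_all add: koszul_sign_def)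
  show "multidegree_part b (\<lambda>A. koszul_boundary c A j) A =
      simplicial_boundary (multidegree_part b (\<lambda>A. c A j)) A"
  proof (cases "exp_le (indicator_exp A) b")
    case True
    then show ?thesis
      by (auto simp: multidegree_part_def koszul_boundary_def simplicial_boundary_def lookup_sum
          mult.assoc sgn lookup_var_mult le eq intro!: sum.cong)
  next
    case False
    then show ?thesis
      by (auto simp: multidegree_part_def simplicial_boundary_def le intro!: sum.neutral)
  qed
qed

lemma lookup_eq_multidegree_part:
  "Poly_Mapping.lookup (c A) m = multidegree_part (m + indicator_exp A) c A"
  by (simp add: multidegree_part_def exp_le_add_self)

lemma multidegree_part_mem:
  assumes "c \<in> koszul_chains i e (monomial_module n S)"
  shows "multidegree_part b (\<lambda>A. c A j) \<in> multigraded_chains i b S"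
  unfolding multigraded_chains_def
proof (intro CollectI allI impI)
  fix A assume nz: "multidegree_part b (\<lambda>A. c A j) A \<noteq> 0"
  then have le: "exp_le (indicator_exp A) b" and k: "b - indicator_exp A \<in> Poly_Mapping.keys (c A j)"
    by (auto simp: multidegree_part_def in_keys_iff split: if_splits)
  have "c A \<noteq> 0" using k by auto
  moreover have "Poly_Mapping.keys (c A j) \<subseteq> S"
    using assms unfolding koszul_chains_def monomial_module_def by blast
  ultimately show "card A = i \<and> exp_le (indicator_exp A) b \<and> b - indicator_exp A \<in> S"
    using assms le k unfolding koszul_chains_def by blast
qed

text \<open>A cycle is split into its multidegree parts, each part is bounded by hypothesis, and the
  bounding chains are reassembled. A chain over sets of size \<open>i\<close> with coefficients of
  degree \<open>e\<close> lives in multidegrees of total degree \<open>e + i\<close>.\<close>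

lemma koszul_vanishing_monomialI:
  fixes S :: "('v::finite \<Rightarrow>\<^sub>0 nat) set"
  assumes bd: "\<And>b (C :: 'v set \<Rightarrow> 'k::comm_ring_1). total_degree b > d + i \<Longrightarrow> C \<in> multigraded_chains i b S \<Longrightarrow>
    simplicial_boundary C = 0 \<Longrightarrow> \<exists>W \<in> multigraded_chains (Suc i) b S. simplicial_boundary W = C"
  shows "koszul_vanishing i d (monomial_module n S :: (nat \<Rightarrow> ('v, 'k) mpoly) set)"
  unfolding koszul_vanishing_def
proof (intro allI impI ballI)
  fix e and c :: "'v set \<Rightarrow> nat \<Rightarrow> ('v, 'k) mpoly"
  assume e: "d < e" and c: "c \<in> koszul_chains i e (monomial_module n S)" and cyc: "koszul_boundary c = 0"
  define Cb where "Cb b j = multidegree_part b (\<lambda>A. c A j)" for b j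
  have "\<exists>W \<in> multigraded_chains (Suc i) b S. simplicial_boundary W = Cb b j"
    if "total_degree b = e + i" for b j
  proof (rule bd)
    show "d + i < total_degree b" using that e by simp
    show "Cb b j \<in> multigraded_chains i b S"
      unfolding Cb_def by (rule multidegree_part_mem[OF c])
    show "simplicial_boundary (Cb b j) = 0"
      unfolding Cb_def multidegree_part_koszul_boundary[symmetric] cyc
      by (auto simp: multidegree_part_def)
  qed
  then obtain W where W: "\<And>b j. total_degree b = e + i \<Longrightarrow> W b j \<in> multigraded_chains (Suc i) b S"
    "\<And>b j. total_degree b = e + i \<Longrightarrow> simplicial_boundary (W b j) = Cb b j"
    by metis
  \<comment> \<open>The coefficient of the monomial \<open>m\<close> at \<open>A\<close> belongs to
    multidegree \<open>m + indicator_exp A\<close>. With \<open>card A = Suc i\<close> and degree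
    \<open>e - 1\<close> this has total degree \<open>e + i\<close>, because \<open>e\<close> is
    positive.\<close>
  define w where "w A j = (if j < n \<and> card A = Suc i then
    \<Sum>m\<in>{m. total_degree m = e - 1}. Poly_Mapping.single m (W (m + indicator_exp A) j A) else 0)" for A j
  have lw: "Poly_Mapping.lookup (w A j) m =
      (if j < n \<and> card A = Suc i \<and> total_degree m = e - 1 then W (m + indicator_exp A) j A else 0)" for A j m
    by (simp add: w_def lookup_sum lookup_single when_def sum.delta[OF finite_total_degree])
  have "w \<in> koszul_chains (Suc i) (e - 1) (monomial_module n S)"
    unfolding koszul_chains_def
  proof (intro CollectI allI conjI impI)
    fix A j
    show "homogeneous (e - 1) (w A j)"
      by (simp add: homogeneous_iff lw)
  next
    fix A
    have "m \<in> S" if m: "m \<in> Poly_Mapping.keys (w A j)" for j m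
    proof -
      have m': "W (m + indicator_exp A) j A \<noteq> 0" "card A = Suc i" "total_degree m = e - 1"
        using m by (auto simp: in_keys_iff lw split: if_splits)
      then have "total_degree (m + indicator_exp A) = e + i"
        using e by (simp add: total_degree_add total_degree_indicator_exp)
      from W(1)[OF this, of j] m' show ?thesis
        by (auto simp: multigraded_chains_def)
    qed
    moreover have "w A \<in> free_module n"
      by (simp add: free_module_def w_def)
    ultimately show "w A \<in> monomial_module n S"
      by (auto simp: monomial_module_def)
  next
    fix A :: "'v set" assume "card A \<noteq> Suc i"
    then show "w A = 0" by (auto simp: w_def)
  qed
  moreover have "koszul_boundary w = c"
  proof (intro ext)
    fix A j
    show "koszul_boundary w A j = c A j"
    proof (cases "j < n")
      case False
      then have "c A j = 0"
        using c by (auto simp: koszul_chains_def monomial_module_def free_module_def)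
      with False show ?thesis by (simp add: koszul_boundary_def w_def)
    next
      case True
      show ?thesis
      proof (rule poly_mapping_eqI)
        fix m
        define b where "b = m + indicator_exp A"
        have mw: "multidegree_part b (\<lambda>A. w A j) B = (if total_degree b = e + i then W b j B else 0)" for B
        proof (cases "exp_le (indicator_exp B) b")
          case le: True
          from total_degree_diff[OF this] total_degree_mono[OF this]
          have "total_degree (b - indicator_exp B) = total_degree b - card B" "card B \<le> total_degree b"
            by (simp_all add: total_degree_indicator_exp)
          moreover have "W b j B = 0" if "total_degree b = e + i" "card B \<noteq> Suc i"
            using W(1)[OF that(1)] that(2) by (auto simp: multigraded_chains_def)
          ultimately show ?thesis
            using le True e by (auto simp: multidegree_part_def lw exp_le_add_diff)
        next
          case False
          moreover have "W b j B = 0" if "total_degree b = e + i"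
            using W(1)[OF that(1)] False by (auto simp: multigraded_chains_def)
          ultimately show ?thesis
            by (auto simp: multidegree_part_def)
        qed
        have *: "Poly_Mapping.lookup (koszul_boundary w A j) m =
            simplicial_boundary (multidegree_part b (\<lambda>A. w A j)) A"
          by (subst lookup_eq_multidegree_part[where c = "\<lambda>A. koszul_boundary w A j"])
            (simp add: b_def multidegree_part_koszul_boundary)
        show "Poly_Mapping.lookup (koszul_boundary w A j) m = Poly_Mapping.lookup (c A j) m"
        proof (cases "total_degree b = e + i")
          case True
          then have "multidegree_part b (\<lambda>A. w A j) = W b j" by (auto simp: mw)
          then have "Poly_Mapping.lookup (koszul_boundary w A j) m = Cb b j A"
            by (simp add: * W(2)[OF True])
          then show ?thesis
            by (simp add: Cb_def b_def lookup_eq_multidegree_part[where c = "\<lambda>A. c A j", symmetric])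
        next
          case False
          then have "Poly_Mapping.lookup (koszul_boundary w A j) m = 0"
            by (simp add: * mw simplicial_boundary_def)
          moreover have "Poly_Mapping.lookup (c A j) m = 0"
          proof (rule ccontr)
            assume nz: "Poly_Mapping.lookup (c A j) m \<noteq> 0"
            then have "c A \<noteq> 0" by auto
            with nz c have "card A = i" "total_degree m = e"
              unfolding koszul_chains_def homogeneous_iff by blast+
            with False show False
              by (simp add: b_def total_degree_add total_degree_indicator_exp)
          qed
          ultimately show ?thesis by simp
        qed
      qed
    qed
  qed
  ultimately show "\<exists>w\<in>koszul_chains (Suc i) (e - 1) (monomial_module n S). koszul_boundary w = c"
    by blast
qed

text \<open>The converse in rank one: a cycle in a single multidegree is turned into a Koszul cycle
  by attaching to each \<open>A\<close> the monomial \<open>b - indicator_exp A\<close>, and a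
  bounding chain is cut down to multidegree \<open>b\<close>.\<close>

lemma koszul_vanishing_monomialD:
  fixes S :: "('v::finite \<Rightarrow>\<^sub>0 nat) set" and C :: "'v set \<Rightarrow> 'k::comm_ring_1"
  assumes van: "koszul_vanishing i d (monomial_module 1 S :: (nat \<Rightarrow> ('v, 'k) mpoly) set)"
    and b: "total_degree b > d + i" and C: "C \<in> multigraded_chains i b S"
    and cyc: "simplicial_boundary C = 0"
  shows "\<exists>W \<in> multigraded_chains (Suc i) b S. simplicial_boundary W = C"
proof -
  define c :: "'v set \<Rightarrow> nat \<Rightarrow> ('v, 'k) mpoly"
    where "c A j = (if j = 0 then Poly_Mapping.single (b - indicator_exp A) (C A) else 0)" for A j
  have C0: "C A \<noteq> 0 \<Longrightarrow> card A = i \<and> exp_le (indicator_exp A) b \<and> b - indicator_exp A \<in> S" for A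
    using C by (simp add: multigraded_chains_def)
  have deg: "total_degree (b - indicator_exp A) = total_degree b - i" if "C A \<noteq> 0" for A
    using C0[OF that] by (simp add: total_degree_diff total_degree_indicator_exp)
  have "c \<in> koszul_chains i (total_degree b - i) (monomial_module 1 S)"
    using C0 deg by (auto simp: koszul_chains_def c_def monomial_module_def free_module_def
        homogeneous_def fun_eq_iff)
  moreover have part: "multidegree_part b' (\<lambda>A. c A 0) A = (if b' = b then C A else 0)" for b' A
  proof (cases "C A = 0")
    case True
    then show ?thesis by (simp add: multidegree_part_def c_def)
  next
    case False
    \<comment> \<open>Truncated subtraction of \<open>indicator_exp A\<close> is cancellable here,
      since both multidegrees dominate it.\<close>
    have "b' = b" if "exp_le (indicator_exp A) b'" "b' - indicator_exp A = b - indicator_exp A"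
      using exp_le_add_diff[OF that(1)] exp_le_add_diff[of "indicator_exp A" b] C0[OF False] that(2) by metis
    then have eq: "exp_le (indicator_exp A) b' \<Longrightarrow> b - indicator_exp A = b' - indicator_exp A \<longleftrightarrow> b' = b"
      by auto
    show ?thesis
      using C0[OF False] by (cases "b' = b") (simp_all add: multidegree_part_def c_def lookup_single when_def eq)
  qed
  have "koszul_boundary c = 0"
  proof (intro ext)
    fix A j
    show "koszul_boundary c A j = 0 A j"
    proof (cases "j = 0")
      case False
      then show ?thesis by (simp add: koszul_boundary_def c_def)
    next
      case True
      have "Poly_Mapping.lookup (koszul_boundary c A 0) m = 0" for m
        using cyc
        by (subst lookup_eq_multidegree_part[where c = "\<lambda>A. koszul_boundary c A 0"])
          (cases "m + indicator_exp A = b",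
            auto simp: multidegree_part_koszul_boundary part fun_eq_iff simplicial_boundary_def)
      with True show ?thesis by (auto intro: poly_mapping_eqI)
    qed
  qed
  moreover have "d < total_degree b - i" using b by simp
  ultimately obtain w where w: "w \<in> koszul_chains (Suc i) (total_degree b - i - 1) (monomial_module 1 S)"
    "koszul_boundary w = c"
    using van unfolding koszul_vanishing_def by blast
  have "simplicial_boundary (multidegree_part b (\<lambda>A. w A 0)) = C"
    unfolding multidegree_part_koszul_boundary[symmetric] w(2) by (rule ext) (simp add: part)
  with multidegree_part_mem[OF w(1)] show ?thesis by blast
qed

text \<open>The second hypothesis says that \<open>x\<close> can be added to every face with
  \<open>i\<close> vertices, which is what coning an \<open>i\<close>-chain requires.\<close>

lemma multigraded_chains_cone:
  assumes C: "C \<in> multigraded_chains i b S"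
    and x: "\<And>A. x \<notin> A \<Longrightarrow> card A = i \<Longrightarrow> exp_le (indicator_exp A) b \<Longrightarrow> b - indicator_exp A \<in> S \<Longrightarrow>
      exp_le (indicator_exp (insert x A)) b \<and> b - indicator_exp (insert x A) \<in> S"
  shows "cone x C \<in> multigraded_chains (Suc i) b S"
  unfolding multigraded_chains_def
proof (intro CollectI allI impI)
  fix A assume "cone x C A \<noteq> 0"
  then have A: "x \<in> A" "C (A - {x}) \<noteq> 0" by (auto simp: cone_def split: if_splits)
  with C have "card (A - {x}) = i" "exp_le (indicator_exp (A - {x})) b" "b - indicator_exp (A - {x}) \<in> S"
    unfolding multigraded_chains_def by blast+
  moreover have "insert x (A - {x}) = A" "card A = Suc (card (A - {x}))"
    using A(1) by (simp_all only: insert_Diff card_Suc_Diff1 finite)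
  ultimately show "card A = Suc i \<and> exp_le (indicator_exp A) b \<and> b - indicator_exp A \<in> S"
    using x[of "A - {x}"] by (metis Diff_iff insertI1)
qed

text \<open>In a multidegree \<open>b\<close> other than zero the complex of the whole ring is the
  full simplex on the support of \<open>b\<close>, hence a cone over any vertex of that
  support.\<close>

lemma koszul_vanishing_free:
  "koszul_vanishing i 0 (free_module n :: (nat \<Rightarrow> ('v::finite, 'k::comm_ring_1) mpoly) set)"
proof -
  have "koszul_vanishing i 0 (monomial_module n UNIV :: (nat \<Rightarrow> ('v, 'k) mpoly) set)"
  proof (rule koszul_vanishing_monomialI)
    fix b and C :: "'v set \<Rightarrow> 'k"
    assume b: "0 + i < total_degree b" and C: "C \<in> multigraded_chains i b UNIV"
      and cyc: "simplicial_boundary C = 0"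
    from b have "b \<noteq> 0" by auto
    then obtain x where x: "Poly_Mapping.lookup b x \<noteq> 0"
      by (metis lookup_zero poly_mapping_eqI)
    have "cone x C \<in> multigraded_chains (Suc i) b UNIV"
      using x by (intro multigraded_chains_cone[OF C]) (auto simp: exp_le_indicator_exp)
    with simplicial_boundary_cone[OF cyc]
    show "\<exists>W\<in>multigraded_chains (Suc i) b UNIV. simplicial_boundary W = C" by blast
  qed
  moreover have "monomial_module n UNIV = (free_module n :: (nat \<Rightarrow> ('v, 'k) mpoly) set)"
    by (simp add: monomial_module_def)
  ultimately show ?thesis by simp
qed

section \<open>Graded submodules and linear resolutions\<close>

lemma sum_fun_apply: "sum f S x = (\<Sum>s\<in>S. f s x)"
  by (induction S rule: infinite_finite_induct) auto

definition vec_scale :: "'a::comm_ring_1 \<Rightarrow> (nat \<Rightarrow> 'a) \<Rightarrow> nat \<Rightarrow> 'a"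
  where "vec_scale a x = (\<lambda>j. a * x j)"

interpretation vec: module "vec_scale :: 'a::comm_ring_1 \<Rightarrow> _"
  by unfold_locales (auto simp: vec_scale_def fun_eq_iff algebra_simps)

lemma subspace_free_module: "vec.subspace (free_module n)"
  by (auto simp: vec.subspace_def free_module_def vec_scale_def)

lemma mat_map_add: "mat_map m n A (x + y) = mat_map m n A x + mat_map m n A y"
  by (auto simp: mat_map_def fun_eq_iff algebra_simps sum.distrib)

lemma mat_map_scale: "mat_map m n A (vec_scale a x) = vec_scale a (mat_map m n A x)"
  by (auto simp: mat_map_def vec_scale_def fun_eq_iff sum_distrib_left algebra_simps)

lemma mat_map_zero [simp]: "mat_map m n A 0 = 0"
  by (auto simp: mat_map_def fun_eq_iff)

lemma mat_map_diff: "mat_map m n A (x - y) = mat_map m n A x - mat_map m n A y"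
  by (auto simp: mat_map_def fun_eq_iff right_diff_distrib sum_subtractf)

lemma mat_map_sum: "mat_map m n A (sum f S) = (\<Sum>s\<in>S. mat_map m n A (f s))"
  by (auto simp: fun_eq_iff mat_map_def sum_fun_apply sum_distrib_left intro: sum.swap)

lemma subspace_mat_map_image: "vec.subspace (mat_map m n A ` free_module n)"
  unfolding vec.subspace_def
proof (intro conjI ballI allI)
  show "0 \<in> mat_map m n A ` free_module n"
    by (rule image_eqI[of _ _ 0]) (simp_all add: vec.subspace_0 subspace_free_module)
next
  fix x y assume "x \<in> mat_map m n A ` free_module n" "y \<in> mat_map m n A ` free_module n"
  then show "x + y \<in> mat_map m n A ` free_module n"
    by (auto simp flip: mat_map_add intro!: imageI vec.subspace_add[OF subspace_free_module])
next
  fix a x assume "x \<in> mat_map m n A ` free_module n"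
  then show "vec_scale a x \<in> mat_map m n A ` free_module n"
    by (auto simp flip: mat_map_scale intro!: imageI vec.subspace_scale[OF subspace_free_module])
qed

lemma subspace_mat_map_kernel: "vec.subspace {x \<in> free_module n. mat_map m n A x = 0}"
  using subspace_free_module[of n]
  by (auto simp: vec.subspace_def mat_map_add mat_map_scale)

section \<open>Koszul chains under homogeneous matrices\<close>

lemma koszul_boundary_eq_sum:
  "koszul_boundary c A = (\<Sum>x\<in>-A. vec_scale (koszul_sign x A * var x) (c (insert x A)))"
  by (rule ext) (simp add: koszul_boundary_def sum_fun_apply vec_scale_def)

lemma koszul_boundary_mat_map:
  "koszul_boundary (\<lambda>A. mat_map m n D (c A)) = (\<lambda>A. mat_map m n D (koszul_boundary c A))"
  by (rule ext) (simp add: koszul_boundary_eq_sum mat_map_sum mat_map_scale)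

lemma koszul_boundary_mem:
  fixes c :: "'v::finite set \<Rightarrow> nat \<Rightarrow> ('v, 'k::comm_ring_1) mpoly"
  assumes c: "c \<in> koszul_chains (Suc i) e M" and M: "vec.subspace M"
  shows "koszul_boundary c \<in> koszul_chains i (Suc e) M"
  unfolding koszul_chains_def
proof (intro CollectI allI conjI impI)
  fix A :: "'v set"
  show "koszul_boundary c A \<in> M"
    unfolding koszul_boundary_eq_sum using c
    by (intro vec.subspace_sum[OF M] vec.subspace_scale[OF M]) (auto simp: koszul_chains_def)
  show "homogeneous (Suc e) (koszul_boundary c A j)" for j
    unfolding koszul_boundary_def koszul_sign_def mult.assoc
    using c homogeneous_mult[OF homogeneous_var, of e]
    by (intro homogeneous_sum homogeneous_sign) (auto simp: koszul_chains_def)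
next
  fix A :: "'v set" assume "card A \<noteq> i"
  then have "c (insert x A) = 0" if "x \<in> - A" for x
    using c that by (auto simp: koszul_chains_def)
  then show "koszul_boundary c A = 0"
    by (auto simp: koszul_boundary_def fun_eq_iff)
qed

lemma koszul_boundary_0_chain:
  assumes "c \<in> koszul_chains 0 e M"
  shows "koszul_boundary c = 0"
proof (intro ext)
  fix A j
  have "c (insert x A) = 0" for x
    using assms unfolding koszul_chains_def by (auto simp: card_eq_0_iff)
  then show "koszul_boundary c A j = 0 A j" by (simp add: koszul_boundary_def)
qed

text \<open>Such a matrix is a graded map on a free module with all generators in degree
  \<open>d\<close>; coordinates of degree \<open>e\<close> are sent to coordinates of degree
  \<open>d + e\<close>.\<close>

definition homogeneous_matrix :: "nat \<Rightarrow> nat \<Rightarrow> nat \<Rightarrow> (nat \<Rightarrow> nat \<Rightarrow> ('v, 'k::comm_ring_1) mpoly) \<Rightarrow> bool"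
  where "homogeneous_matrix d m n D \<longleftrightarrow> (\<forall>r<m. \<forall>c<n. homogeneous d (D r c))"

lemma homogeneous_mat_map:
  fixes D :: "nat \<Rightarrow> nat \<Rightarrow> ('v::finite, 'k::comm_ring_1) mpoly"
  assumes "homogeneous_matrix d m n D" "\<And>j. homogeneous e (x j)"
  shows "homogeneous (d + e) (mat_map m n D x r)"
  using assms by (auto simp: mat_map_def homogeneous_matrix_def intro!: homogeneous_sum homogeneous_mult)

lemma hcomp_mat_map:
  fixes D :: "nat \<Rightarrow> nat \<Rightarrow> ('v::finite, 'k::comm_ring_1) mpoly"
  assumes "homogeneous_matrix d m n D"
  shows "mat_map m n D (\<lambda>j. hcomp e (x j)) = (\<lambda>j. hcomp (d + e) (mat_map m n D x j))"
  using assms by (auto simp: mat_map_def fun_eq_iff homogeneous_matrix_def hcomp_sum hcomp_mult)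

lemma koszul_chains_mat_map:
  fixes D :: "nat \<Rightarrow> nat \<Rightarrow> ('v::finite, 'k::comm_ring_1) mpoly"
  assumes "homogeneous_matrix d m n D" "c \<in> koszul_chains i e (free_module n)"
  shows "(\<lambda>A. mat_map m n D (c A)) \<in> koszul_chains i (d + e) (mat_map m n D ` free_module n)"
  using assms by (auto simp: koszul_chains_def homogeneous_mat_map)

lemma koszul_chains_lift:
  fixes D :: "nat \<Rightarrow> nat \<Rightarrow> ('v::finite, 'k::comm_ring_1) mpoly"
  assumes D: "homogeneous_matrix d m n D"
    and c: "c \<in> koszul_chains i (d + e) (mat_map m n D ` free_module n)"
  obtains y where "y \<in> koszul_chains i e (free_module n)" "(\<lambda>A. mat_map m n D (y A)) = c"
proof -
  have "\<exists>y \<in> free_module n. (\<forall>j. homogeneous e (y j)) \<and> mat_map m n D y = c A" for A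
  proof -
    obtain x where x: "x \<in> free_module n" "c A = mat_map m n D x"
      using c by (auto simp: koszul_chains_def)
    \<comment> \<open>Any preimage may be replaced by its component of degree \<open>e\<close>,
      since the matrix raises degrees by exactly \<open>d\<close> and \<open>c A\<close> is
      homogeneous of degree \<open>d + e\<close>.\<close>
    have "mat_map m n D (\<lambda>j. hcomp e (x j)) = (\<lambda>j. hcomp (d + e) (c A j))"
      by (simp add: hcomp_mat_map[OF D] x)
    also have "\<dots> = c A"
      using c by (simp add: koszul_chains_def hcomp_same)
    finally have "mat_map m n D (\<lambda>j. hcomp e (x j)) = c A" .
    moreover have "(\<lambda>j. hcomp e (x j)) \<in> free_module n"
      using x by (auto simp: free_module_def)
    ultimately show ?thesis by (intro bexI[of _ "\<lambda>j. hcomp e (x j)"] conjI allI homogeneous_hcomp)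
  qed
  then obtain y where y: "\<And>A. y A \<in> free_module n" "\<And>A j. homogeneous e (y A j)"
    "\<And>A. mat_map m n D (y A) = c A" by metis
  \<comment> \<open>The preimage chosen for a zero value need not be zero, so the lift is reset to
    zero on sets of the wrong size.\<close>
  define y' where "y' A = (if card A = i then y A else 0)" for A
  have "y' \<in> koszul_chains i e (free_module n)"
    using y by (auto simp: koszul_chains_def y'_def vec.subspace_0 subspace_free_module)
  moreover have "(\<lambda>A. mat_map m n D (y' A)) = c"
    using c y(3) by (auto simp: koszul_chains_def y'_def fun_eq_iff)
  ultimately show thesis using that by blast
qed

text \<open>Every 0-chain is a cycle, so it can be lifted to the free module, bounded there, and
  mapped back.\<close>

lemma koszul_vanishing_image_0:
  fixes D :: "nat \<Rightarrow> nat \<Rightarrow> ('v::finite, 'k::comm_ring_1) mpoly"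
  assumes D: "homogeneous_matrix d m n D"
  shows "koszul_vanishing 0 d (mat_map m n D ` free_module n)"
  unfolding koszul_vanishing_def
proof (intro allI impI ballI)
  fix e c assume e: "d < e" and c: "c \<in> koszul_chains 0 e (mat_map m n D ` free_module n)"
  have e': "e = d + (e - d)" "e - 1 = d + (e - d - 1)" "0 < e - d" using e by auto
  obtain y where y: "y \<in> koszul_chains 0 (e - d) (free_module n)" "(\<lambda>A. mat_map m n D (y A)) = c"
    using koszul_chains_lift[OF D] c e'(1) by metis
  obtain w where w: "w \<in> koszul_chains (Suc 0) (e - d - 1) (free_module n)" "koszul_boundary w = y"
    using koszul_vanishing_free[of 0 n] koszul_boundary_0_chain[OF y(1)] y(1) e'(3)
    unfolding koszul_vanishing_def by blast
  show "\<exists>w\<in>koszul_chains (Suc 0) (e - 1) (mat_map m n D ` free_module n). koszul_boundary w = c"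
    using koszul_chains_mat_map[OF D w(1)] e'(2) w(2) y(2)
    by (intro bexI[of _ "\<lambda>A. mat_map m n D (w A)"]) (simp_all add: koszul_boundary_mat_map)
qed

text \<open>Let \<open>Z\<close> be the kernel, \<open>F\<close> the free module and
  \<open>M\<close> the image. In the long exact sequence \<open>H_(i+1)(M)\<close> sits between
  \<open>H_(i+1)(F)\<close> and \<open>H_i(Z)\<close>, which both vanish in the degrees
  concerned.\<close>

lemma koszul_vanishing_image_Suc:
  fixes D :: "nat \<Rightarrow> nat \<Rightarrow> ('v::finite, 'k::comm_ring_1) mpoly"
  assumes D: "homogeneous_matrix d m n D"
    and ker: "koszul_vanishing i 1 {x \<in> free_module n. mat_map m n D x = 0}"
  shows "koszul_vanishing (Suc i) d (mat_map m n D ` free_module n)"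
  unfolding koszul_vanishing_def
proof (intro allI impI ballI)
  fix e c assume e: "d < e" and c: "c \<in> koszul_chains (Suc i) e (mat_map m n D ` free_module n)"
    and cyc: "koszul_boundary c = 0"
  define f where "f = e - d"
  have f: "e = d + f" "e - 1 = d + (f - 1)" "0 < f" using e by (auto simp: f_def)
  obtain y where y: "y \<in> koszul_chains (Suc i) f (free_module n)" "(\<lambda>A. mat_map m n D (y A)) = c"
    using koszul_chains_lift[OF D] c f(1) by metis
  have "(\<lambda>A. mat_map m n D (koszul_boundary y A)) = 0"
    using y(2) cyc by (simp flip: koszul_boundary_mat_map)
  then have "koszul_boundary y \<in> koszul_chains i (Suc f) {x \<in> free_module n. mat_map m n D x = 0}"
    using koszul_boundary_mem[OF y(1) subspace_free_module] by (auto simp: koszul_chains_def fun_eq_iff)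
  moreover have "koszul_boundary (koszul_boundary y) = 0" by (rule koszul_boundary_boundary)
  moreover have "1 < Suc f" using f by simp
  ultimately obtain w where w: "w \<in> koszul_chains (Suc i) (Suc f - 1) {x \<in> free_module n. mat_map m n D x = 0}"
    "koszul_boundary w = koszul_boundary y"
    using ker unfolding koszul_vanishing_def by blast
  \<comment> \<open>Subtracting \<open>w\<close>, which the matrix kills, turns the lift
    \<open>y\<close> into a cycle of the free module without changing its image
    \<open>c\<close>.\<close>
  have "y - w \<in> koszul_chains (Suc i) f (free_module n)"
    using y(1) w(1) by (auto simp: koszul_chains_def homogeneous_diff vec.subspace_diff[OF subspace_free_module])
  moreover have "koszul_boundary (y - w) = 0" by (simp add: koszul_boundary_diff w)
  ultimately obtain v where v: "v \<in> koszul_chains (Suc (Suc i)) (f - 1) (free_module n)" "koszul_boundary v = y - w"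
    using koszul_vanishing_free[of "Suc i" n] f(3) unfolding koszul_vanishing_def by blast
  have "(\<lambda>A. mat_map m n D (koszul_boundary v A)) = c"
    using w(1) y(2) by (auto simp: v mat_map_diff koszul_chains_def fun_eq_iff)
  with koszul_chains_mat_map[OF D v(1)] f(2)
  show "\<exists>w\<in>koszul_chains (Suc (Suc i)) (e - 1) (mat_map m n D ` free_module n). koszul_boundary w = c"
    by (intro bexI[of _ "\<lambda>A. mat_map m n D (v A)"]) (simp_all add: koszul_boundary_mat_map)
qed

text \<open>The same long exact sequence, read one place further: \<open>H_i\<close> of the kernel
  sits between \<open>H_(i+1)\<close> of the image and \<open>H_i\<close> of the free
  module.\<close>

lemma koszul_vanishing_kernel:
  fixes D :: "nat \<Rightarrow> nat \<Rightarrow> ('v::finite, 'k::comm_ring_1) mpoly"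
  assumes D: "homogeneous_matrix d m n D"
    and im: "koszul_vanishing (Suc i) d (mat_map m n D ` free_module n)"
  shows "koszul_vanishing i 1 {x \<in> free_module n. mat_map m n D x = 0}"
  unfolding koszul_vanishing_def
proof (intro allI impI ballI)
  let ?Z = "{x \<in> free_module n. mat_map m n D x = 0}"
  fix e c assume e: "1 < e" and c: "c \<in> koszul_chains i e ?Z" and cyc: "koszul_boundary c = 0"
  have "c \<in> koszul_chains i e (free_module n)"
    using c by (auto simp: koszul_chains_def)
  moreover have "0 < e" using e by simp
  ultimately obtain y where y: "y \<in> koszul_chains (Suc i) (e - 1) (free_module n)" "koszul_boundary y = c"
    using koszul_vanishing_free[of i n] cyc unfolding koszul_vanishing_def by blast
  have "koszul_boundary (\<lambda>A. mat_map m n D (y A)) = 0"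
    using c by (auto simp: koszul_boundary_mat_map y koszul_chains_def fun_eq_iff)
  \<comment> \<open>This needs \<open>e\<close> to exceed one, and is the reason why the bound for
    the kernel is 1 rather than 0.\<close>
  moreover have "d < d + (e - 1)" using e by simp
  ultimately obtain u where u: "u \<in> koszul_chains (Suc (Suc i)) (d + (e - 1) - 1) (mat_map m n D ` free_module n)"
    "koszul_boundary u = (\<lambda>A. mat_map m n D (y A))"
    using im koszul_chains_mat_map[OF D y(1)] unfolding koszul_vanishing_def by blast
  have "d + (e - 1) - 1 = d + (e - 2)" using e by simp
  with u(1) obtain v where v: "v \<in> koszul_chains (Suc (Suc i)) (e - 2) (free_module n)"
    "(\<lambda>A. mat_map m n D (v A)) = u"
    using koszul_chains_lift[OF D] by metis
  \<comment> \<open>The correction term: \<open>y\<close> and \<open>koszul_boundary v\<close> have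
    the same image, so their difference takes values in the kernel and still bounds
    \<open>c\<close>.\<close>
  have "koszul_boundary v \<in> koszul_chains (Suc i) (e - 1) (free_module n)"
    using koszul_boundary_mem[OF v(1) subspace_free_module] e by (simp add: numeral_2_eq_2 Suc_diff_Suc)
  moreover have "mat_map m n D (y A - koszul_boundary v A) = 0" for A
    using fun_cong[OF u(2), of A]
    by (simp add: mat_map_diff v(2)[symmetric] koszul_boundary_mat_map)
  ultimately have "y - koszul_boundary v \<in> koszul_chains (Suc i) (e - 1) ?Z"
    using y(1) by (auto simp: koszul_chains_def homogeneous_diff vec.subspace_diff[OF subspace_free_module])
  moreover have "koszul_boundary (y - koszul_boundary v) = c"
    by (simp add: koszul_boundary_diff koszul_boundary_boundary y)
  ultimately show "\<exists>w\<in>koszul_chains (Suc i) (e - 1) ?Z. koszul_boundary w = c" by blast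
qed

text \<open>By exactness each kernel is the next image, so homology in position \<open>Suc i\<close>
  at stage \<open>s\<close> is reduced to position \<open>i\<close> at stage \<open>Suc s\<close>;
  hence the induction on \<open>i\<close> for all stages at once.\<close>

lemma koszul_vanishing_resolution:
  fixes D :: "nat \<Rightarrow> nat \<Rightarrow> nat \<Rightarrow> ('v::finite, 'k::comm_ring_1) mpoly"
  assumes D: "\<And>s. homogeneous_matrix (d s) (b s) (b (Suc s)) (D s)" "\<And>s. d (Suc s) = 1"
    and ex: "\<And>s. mat_map (b (Suc s)) (b (Suc (Suc s))) (D (Suc s)) ` free_module (b (Suc (Suc s))) =
      {x \<in> free_module (b (Suc s)). mat_map (b s) (b (Suc s)) (D s) x = 0}"
  shows "koszul_vanishing i (d s) (mat_map (b s) (b (Suc s)) (D s) ` free_module (b (Suc s)))"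
proof (induction i arbitrary: s)
  case 0
  show ?case by (rule koszul_vanishing_image_0[OF D(1)])
next
  case (Suc i)
  show ?case
    using Suc[of "Suc s"] unfolding ex D(2) by (intro koszul_vanishing_image_Suc D)
qed

section \<open>Modules with linear Koszul homology and their minimal covers\<close>

text \<open>The invariant of the resolution built below: a graded submodule starting in degree at
  least \<open>d\<close>, whose Koszul homology has no coefficients of degree above
  \<open>d\<close>.\<close>

definition linear_module :: "nat \<Rightarrow> nat \<Rightarrow> (nat \<Rightarrow> ('v::finite, 'k::comm_ring_1) mpoly) set \<Rightarrow> bool"
  where "linear_module d m M \<longleftrightarrow> M \<subseteq> free_module m \<and> vec.subspace M \<and>
    (\<forall>x \<in> M. \<forall>e. (\<lambda>j. hcomp e (x j)) \<in> M \<and> (e < d \<longrightarrow> (\<lambda>j. hcomp e (x j)) = 0)) \<and>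
    (\<forall>i. koszul_vanishing i d M)"

text \<open>Vectors of fixed degree form a finite-dimensional space over the field, so a maximal
  independent subset of \<open>V\<close> is finite. Spanning will give generators, and independence
  will give minimality.\<close>

lemma homogeneous_finite_basis:
  fixes V :: "(nat \<Rightarrow> ('v::finite, 'k::field) mpoly) set"
  assumes V: "V \<subseteq> {x \<in> free_module m. \<forall>j. homogeneous d (x j)}"
  shows "\<exists>(b::nat) \<beta>. (\<forall>c<b. \<beta> c \<in> V) \<and>
    (\<forall>x\<in>V. \<exists>a. x = (\<Sum>c<b. vec_scale (Poly_Mapping.single 0 (a c)) (\<beta> c))) \<and>
    (\<forall>a. (\<Sum>c<b. vec_scale (Poly_Mapping.single 0 (a c)) (\<beta> c)) = 0 \<longrightarrow> (\<forall>c<b. a c = 0))"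
proof -
  \<comment> \<open>Field scalars act through constant polynomials, which makes the linear algebra
    of vector spaces available.\<close>
  define sc :: "'k \<Rightarrow> (nat \<Rightarrow> ('v, 'k) mpoly) \<Rightarrow> nat \<Rightarrow> ('v, 'k) mpoly"
    where "sc a = vec_scale (Poly_Mapping.single 0 a)" for a
  interpret sc: vector_space sc
    by unfold_locales
      (simp_all add: sc_def vec.scale_left_distrib vec.scale_right_distrib single_add mult_single)
  obtain B where B: "B \<subseteq> V" "sc.independent B" "V \<subseteq> sc.span B"
    by (rule sc.maximal_independent_subset)
  \<comment> \<open>The monomial multiples of unit vectors in degree \<open>d\<close>, a finite set
    spanning all candidates for \<open>V\<close>.\<close>
  define T :: "(nat \<Rightarrow> ('v, 'k) mpoly) set" where
    "T = (\<lambda>(r, u) j. if j = r then Poly_Mapping.single u 1 else 0) ` ({..<m} \<times> {u. total_degree u = d})"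
  have "finite T" by (simp add: T_def finite_total_degree)
  have "V \<subseteq> sc.span T"
  proof
    fix x assume "x \<in> V"
    then have x: "x \<in> free_module m" "\<And>j. homogeneous d (x j)" using V by auto
    have "x = (\<Sum>r<m. \<Sum>u | total_degree u = d.
        sc (Poly_Mapping.lookup (x r) u) (\<lambda>j. if j = r then Poly_Mapping.single u 1 else 0))"
    proof (intro ext poly_mapping_eqI)
      fix j u
      have "Poly_Mapping.lookup ((\<Sum>r<m. \<Sum>u | total_degree u = d.
          sc (Poly_Mapping.lookup (x r) u) (\<lambda>j. if j = r then Poly_Mapping.single u 1 else 0)) j) u =
        (\<Sum>r<m. if j = r then (\<Sum>w | total_degree w = d. if w = u then Poly_Mapping.lookup (x r) w else 0) else 0)"
        unfolding sum_fun_apply lookup_sum sc_def vec_scale_def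
        by (intro sum.cong refl) (auto simp: mult_single lookup_single when_def intro!: sum.cong sum.neutral)
      also have "\<dots> = (if j < m \<and> total_degree u = d then Poly_Mapping.lookup (x j) u else 0)"
        by (simp add: sum.delta[OF finite_total_degree])
      also have "\<dots> = Poly_Mapping.lookup (x j) u"
        using x by (auto simp: free_module_def homogeneous_iff not_less)
      finally show "Poly_Mapping.lookup (x j) u = Poly_Mapping.lookup ((\<Sum>r<m. \<Sum>u | total_degree u = d.
          sc (Poly_Mapping.lookup (x r) u) (\<lambda>j. if j = r then Poly_Mapping.single u 1 else 0)) j) u" ..
    qed
    also have "\<dots> \<in> sc.span T"
      by (intro sc.span_sum sc.span_scale sc.span_base) (auto simp: T_def)
    finally show "x \<in> sc.span T" .
  qed
  with B have "finite B"
    using sc.independent_span_bound[OF \<open>finite T\<close> B(2)] by blast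
  then obtain \<beta> where \<beta>: "bij_betw \<beta> {..<card B} B"
    using ex_bij_betw_nat_finite by (metis atLeast0LessThan)
  have reindex: "(\<Sum>v\<in>B. sc (u v) v) = (\<Sum>c<card B. sc (u (\<beta> c)) (\<beta> c))" for u
    by (rule sum.reindex_bij_betw[OF \<beta>, symmetric])
  show ?thesis
  proof (intro exI[of _ "card B"] exI[of _ \<beta>] conjI allI ballI impI)
    show "\<beta> c \<in> V" if "c < card B" for c
      using \<beta> B that by (auto simp: bij_betw_def)
    show "\<exists>a. x = (\<Sum>c<card B. vec_scale (Poly_Mapping.single 0 (a c)) (\<beta> c))" if "x \<in> V" for x
    proof -
      have "x \<in> range (\<lambda>u. \<Sum>v\<in>B. sc (u v) v)"
        using subsetD[OF B(3) that] unfolding sc.span_finite[OF \<open>finite B\<close>] .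
      then obtain u where "x = (\<Sum>v\<in>B. sc (u v) v)" by (rule imageE)
      then have "x = (\<Sum>c<card B. vec_scale (Poly_Mapping.single 0 (u (\<beta> c))) (\<beta> c))"
        unfolding reindex by (simp only: sc_def)
      then show ?thesis by (rule exI[of _ "\<lambda>c. u (\<beta> c)"])
    qed
    show "a c = 0" if 0: "(\<Sum>c<card B. vec_scale (Poly_Mapping.single 0 (a c)) (\<beta> c)) = 0" and c: "c < card B" for a c
    proof -
      define u where "u = a \<circ> the_inv_into {..<card B} \<beta>"
      have u: "u (\<beta> c) = a c" if "c < card B" for c
        using \<beta> that by (simp add: u_def bij_betw_def the_inv_into_f_f)
      have "(\<Sum>v\<in>B. sc (u v) v) = 0"
        unfolding reindex using 0 by (simp add: sc_def u)
      then have "u (\<beta> c) = 0"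
        using sc.independentD[OF B(2) \<open>finite B\<close>] \<beta> c by (auto simp: bij_betw_def)
      with u c show ?thesis by simp
    qed
  qed
qed

lemma mat_map_columns:
  assumes "\<And>c. c < n \<Longrightarrow> \<beta> c \<in> free_module m"
  shows "mat_map m n (\<lambda>r c. \<beta> c r) x = (\<Sum>c<n. vec_scale (x c) (\<beta> c))"
  using assms by (auto simp: mat_map_def fun_eq_iff sum_fun_apply vec_scale_def free_module_def mult.commute
      intro!: sum.cong sum.neutral)

lemma vec_sum_hcomp:
  assumes "x \<in> free_module m"
  obtains N where "x = (\<Sum>e<N. (\<lambda>j. hcomp e (x j)))"
proof -
  define F where "F = (\<Union>j<m. total_degree ` Poly_Mapping.keys (x j))"
  have "finite F" by (simp add: F_def)
  then obtain N where N: "F \<subseteq> {..<N}" unfolding finite_nat_set_iff_bounded by blast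
  have "x j = (\<Sum>e<N. hcomp e (x j))" for j
  proof (cases "j < m")
    case True
    then have "total_degree ` Poly_Mapping.keys (x j) \<subseteq> {..<N}" using N by (auto simp: F_def)
    then show ?thesis by (simp add: sum_hcomp)
  next
    case False
    then show ?thesis using assms by (simp add: free_module_def)
  qed
  then show thesis by (intro that[of N]) (auto simp: fun_eq_iff sum_fun_apply)
qed

text \<open>Nakayama's lemma, degree by degree: \<open>H\<^sub>0\<close> lives in degree \<open>d\<close>, so \<open>M\<^sub>d\<close> generates.\<close>

lemma generated_in_degree:
  fixes M N :: "(nat \<Rightarrow> ('v::finite, 'k::comm_ring_1) mpoly) set"
  assumes M: "linear_module d m M" and N: "vec.subspace N"
    and d: "\<And>x. x \<in> M \<Longrightarrow> (\<And>j. homogeneous d (x j)) \<Longrightarrow> x \<in> N"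
  shows "M \<subseteq> N"
proof
  have hom: "x \<in> N" if "x \<in> M" "\<And>j. homogeneous e (x j)" for e x
    using that
  proof (induction e arbitrary: x rule: less_induct)
    case (less e)
    consider "e < d" | "e = d" | "d < e" by linarith
    then show ?case
    proof cases
      case 1
      have "(\<lambda>j. hcomp e (x j)) = 0"
        using M less.prems(1) 1 by (auto simp: linear_module_def)
      moreover have "(\<lambda>j. hcomp e (x j)) = x"
        using less.prems(2) by (simp add: hcomp_same)
      ultimately have "x = 0" by simp
      then show ?thesis using vec.subspace_0[OF N] by metis
    next
      case 2
      with less.prems d show ?thesis by blast
    next
      case 3
      define c where "c A = (if A = {} then x else 0)" for A :: "'v set"
      have c: "c \<in> koszul_chains 0 e M"
        using less.prems M by (auto simp: koszul_chains_def c_def linear_module_def vec.subspace_0)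
      obtain w where w: "w \<in> koszul_chains (Suc 0) (e - 1) M" "koszul_boundary w = c"
        using M 3 c koszul_boundary_0_chain[OF c] unfolding linear_module_def koszul_vanishing_def by blast
      have "w A \<in> N" for A
        using w(1) 3 by (intro less.IH[of "e - 1"]) (auto simp: koszul_chains_def)
      then have "koszul_boundary w {} \<in> N"
        unfolding koszul_boundary_eq_sum by (intro vec.subspace_sum[OF N] vec.subspace_scale[OF N])
      then show ?thesis by (simp add: w(2) c_def)
    qed
  qed
  fix x assume x: "x \<in> M"
  with M have "x \<in> free_module m" by (auto simp: linear_module_def)
  then obtain K where K: "x = (\<Sum>e<K. (\<lambda>j. hcomp e (x j)))" by (rule vec_sum_hcomp)
  have "(\<Sum>e<K. (\<lambda>j. hcomp e (x j))) \<in> N"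
    using M x by (intro vec.subspace_sum[OF N] hom[OF _ homogeneous_hcomp]) (auto simp: linear_module_def)
  then show "x \<in> N" unfolding K[symmetric] .
qed

text \<open>The columns of \<open>D\<close> are a basis of the degree \<open>d\<close> part of
  \<open>M\<close> over the field. They generate \<open>M\<close> by
  \<open>generated_in_degree\<close>, and the kernel inherits the vanishing by
  \<open>koszul_vanishing_kernel\<close>, now with bound 1.\<close>

lemma linear_module_step:
  fixes M :: "(nat \<Rightarrow> ('v::finite, 'k::field) mpoly) set"
  assumes M: "linear_module d m M"
  obtains n D where "homogeneous_matrix d m n D" "mat_map m n D ` free_module n = M"
    "linear_module 1 n {x \<in> free_module n. mat_map m n D x = 0}"
proof -
  let ?V = "{x \<in> M. \<forall>j. homogeneous d (x j)}"
  have sub: "vec.subspace M" "M \<subseteq> free_module m" using M by (auto simp: linear_module_def)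
  have "?V \<subseteq> {x \<in> free_module m. \<forall>j. homogeneous d (x j)}" using sub by auto
  from homogeneous_finite_basis[OF this] obtain n :: nat and \<beta> where
    \<beta>: "\<forall>c<n. \<beta> c \<in> ?V"
      "\<forall>x\<in>?V. \<exists>a. x = (\<Sum>c<n. vec_scale (Poly_Mapping.single 0 (a c)) (\<beta> c))"
      "\<forall>a. (\<Sum>c<n. vec_scale (Poly_Mapping.single 0 (a c)) (\<beta> c)) = 0 \<longrightarrow> (\<forall>c<n. a c = 0)"
    by (elim exE conjE)
  define D where "D r c = \<beta> c r" for r c
  have cols: "mat_map m n D x = (\<Sum>c<n. vec_scale (x c) (\<beta> c))" for x
    unfolding D_def using \<beta>(1) sub by (intro mat_map_columns) auto
  have hom: "homogeneous_matrix d m n D"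
    using \<beta>(1) by (auto simp: homogeneous_matrix_def D_def)
  have im: "mat_map m n D ` free_module n = M"
  proof
    show "mat_map m n D ` free_module n \<subseteq> M"
      using \<beta>(1) by (auto simp: cols intro!: vec.subspace_sum[OF sub(1)] vec.subspace_scale[OF sub(1)])
    show "M \<subseteq> mat_map m n D ` free_module n"
    proof (rule generated_in_degree[OF M subspace_mat_map_image])
      fix x assume "x \<in> M" "\<And>j. homogeneous d (x j)"
      then obtain a where a: "x = (\<Sum>c<n. vec_scale (Poly_Mapping.single 0 (a c)) (\<beta> c))"
        using \<beta>(2) by blast
      have eq: "x = mat_map m n D (\<lambda>c. if c < n then Poly_Mapping.single 0 (a c) else 0)"
        by (simp add: cols a)
      show "x \<in> mat_map m n D ` free_module n"
        unfolding eq by (intro imageI) (simp add: free_module_def)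
    qed
  qed
  have "linear_module 1 n {x \<in> free_module n. mat_map m n D x = 0}" (is "linear_module 1 n ?Z")
    unfolding linear_module_def
  proof (intro conjI allI ballI impI)
    show "?Z \<subseteq> free_module n" by auto
    show "vec.subspace ?Z" by (rule subspace_mat_map_kernel)
    show "koszul_vanishing i 1 ?Z" for i
      using M by (intro koszul_vanishing_kernel[OF hom]) (simp add: im linear_module_def)
  next
    fix x e assume x: "x \<in> ?Z"
    then show hx: "(\<lambda>j. hcomp e (x j)) \<in> ?Z"
      by (auto simp: hcomp_mat_map[OF hom] free_module_def fun_eq_iff)
    assume "e < 1"
    then have e: "e = 0" by simp
    \<comment> \<open>The constant parts of a relation form a linear relation over the field between
      the basis vectors, so they vanish and the kernel starts in degree 1.\<close>
    define a where "a c = Poly_Mapping.lookup (hcomp 0 (x c)) 0" for c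
    have a: "hcomp 0 (x c) = Poly_Mapping.single 0 (a c)" for c
      unfolding a_def by (rule homogeneous_0_const[OF homogeneous_hcomp])
    have "(\<Sum>c<n. vec_scale (Poly_Mapping.single 0 (a c)) (\<beta> c)) = 0"
      using hx by (simp add: cols a e)
    with \<beta>(3) have "\<forall>c<n. a c = 0" by (elim allE[of _ a] mp)
    then have "hcomp 0 (x c) = 0" if "c < n" for c using that by (simp add: a)
    moreover have "hcomp 0 (x c) = 0" if "\<not> c < n" for c using that x by (simp add: free_module_def)
    ultimately show "(\<lambda>j. hcomp e (x j)) = 0" unfolding e by (auto simp: fun_eq_iff)
  qed
  with hom im that show thesis by blast
qed

section \<open>Linear resolutions of ideals and Koszul vanishing\<close>

definition ideal_as_module :: "'a::comm_ring_1 set \<Rightarrow> (nat \<Rightarrow> 'a) set"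
  where "ideal_as_module I = {x \<in> free_module 1. x 0 \<in> I}"

lemma mat_map_row_image:
  "mat_map 1 n (\<lambda>_. g) ` free_module n = ideal_as_module ((\<lambda>x. \<Sum>j<n. g j * x j) ` free_module n)"
proof
  show "mat_map 1 n (\<lambda>_. g) ` free_module n \<subseteq> ideal_as_module ((\<lambda>x. \<Sum>j<n. g j * x j) ` free_module n)"
    by (auto simp: ideal_as_module_def mat_map_def free_module_def)
  show "ideal_as_module ((\<lambda>x. \<Sum>j<n. g j * x j) ` free_module n) \<subseteq> mat_map 1 n (\<lambda>_. g) ` free_module n"
  proof
    fix y assume "y \<in> ideal_as_module ((\<lambda>x. \<Sum>j<n. g j * x j) ` free_module n)"
    then obtain x where "x \<in> free_module n" "y 0 = (\<Sum>j<n. g j * x j)" "y \<in> free_module 1"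
      by (auto simp: ideal_as_module_def)
    then show "y \<in> mat_map 1 n (\<lambda>_. g) ` free_module n"
      by (intro image_eqI[of _ _ x]) (auto simp: mat_map_def free_module_def fun_eq_iff)
  qed
qed

lemma ideal_as_module_inj: "ideal_as_module I = ideal_as_module J \<Longrightarrow> I = (J :: 'a::comm_ring_1 set)"
proof -
  have "I \<subseteq> J" if "ideal_as_module I = ideal_as_module J" for I J :: "'a set"
  proof
    fix f assume "f \<in> I"
    then have "(\<lambda>j. if j = 0 then f else 0) \<in> ideal_as_module J"
      unfolding that[symmetric] by (simp add: ideal_as_module_def free_module_def)
    then show "f \<in> J" by (simp add: ideal_as_module_def)
  qed
  then show "ideal_as_module I = ideal_as_module J \<Longrightarrow> I = J" by (metis subset_antisym)
qed

lemma mat_map_row_eq_0_iff: "mat_map 1 n (\<lambda>_. g) x = 0 \<longleftrightarrow> (\<Sum>j<n. g j * x j) = 0"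
  by (auto simp: mat_map_def fun_eq_iff)

text \<open>The generators \<open>g\<close> of degree \<open>d\<close> are returned as well, so that
  \<open>d\<close> can later be compared with the degree of a component.\<close>

lemma has_linear_resolution_koszul_vanishing:
  fixes I :: "('v::finite, 'k::field) mpoly set"
  assumes "has_linear_resolution I"
  shows "\<exists>d n g. (\<forall>i. koszul_vanishing i d (ideal_as_module I)) \<and>
    (\<forall>j<n. homogeneous d (g j)) \<and> I = (\<lambda>x. \<Sum>j<n. g j * x j) ` free_module n"
proof -
  from assms obtain d b s g D where res: "graded_free_resolution I b s g D"
    and s: "\<And>i j. j < b i \<Longrightarrow> s i j = d + i"
    unfolding has_linear_resolution_def minimal_graded_free_resolution_def by blast
  have g: "homogeneous d (g j)" if "j < b 0" for j
    using res s[OF that] that by (auto simp: graded_free_resolution_def)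
  note res' = res[unfolded graded_free_resolution_def, folded zero_fun_def]
  have deg: "\<forall>i. \<forall>r < b i. \<forall>c < b (Suc i). \<forall>m \<in> Poly_Mapping.keys (D i r c).
      s i r + total_degree m = s (Suc i) c"
    using res' by (elim conjE)
  have im: "(\<lambda>x. \<Sum>j<b 0. g j * x j) ` free_module (b 0) = I"
    using res' by (elim conjE)
  have ex0: "mat_map (b 0) (b 1) (D 0) ` free_module (b 1) =
      {x \<in> free_module (b 0). (\<Sum>j<b 0. g j * x j) = 0}"
    using res' by (elim conjE)
  have ex: "\<forall>i. mat_map (b (Suc i)) (b (Suc (Suc i))) (D (Suc i)) ` free_module (b (Suc (Suc i))) =
      {x \<in> free_module (b (Suc i)). mat_map (b i) (b (Suc i)) (D i) x = 0}"
    using res' by (elim conjE)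
  \<comment> \<open>The shifts of consecutive free modules differ by one, which makes all matrix
    entries linear forms.\<close>
  have D: "homogeneous_matrix 1 (b i) (b (Suc i)) (D i)" for i
    unfolding homogeneous_matrix_def homogeneous_def
  proof (intro allI impI ballI)
    fix r c m assume rc: "r < b i" "c < b (Suc i)" "m \<in> Poly_Mapping.keys (D i r c)"
    then have "s i r + total_degree m = s (Suc i) c"
      using deg by blast
    then show "total_degree m = 1" using s[OF rc(1)] s[OF rc(2)] by simp
  qed
  \<comment> \<open>The augmentation is prepended as a matrix with the single row \<open>g\<close>,
    so that stage 0 has the ideal as its image and the given differentials move up by one.\<close>
  define b' where "b' = case_nat 1 b"
  define D' where "D' = case_nat (\<lambda>_. g) D"
  have "koszul_vanishing i (case 0 of 0 \<Rightarrow> d | Suc _ \<Rightarrow> 1)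
      (mat_map (b' 0) (b' (Suc 0)) (D' 0) ` free_module (b' (Suc 0)))" for i
  proof (rule koszul_vanishing_resolution[where d = "case_nat d (\<lambda>_. 1)"])
    show "homogeneous_matrix (case s of 0 \<Rightarrow> d | Suc _ \<Rightarrow> 1) (b' s) (b' (Suc s)) (D' s)" for s
      using g D by (cases s) (auto simp: b'_def D'_def homogeneous_matrix_def)
    show "mat_map (b' (Suc s)) (b' (Suc (Suc s))) (D' (Suc s)) ` free_module (b' (Suc (Suc s))) =
      {x \<in> free_module (b' (Suc s)). mat_map (b' s) (b' (Suc s)) (D' s) x = 0}" for s
    proof (cases s)
      case 0
      show ?thesis using ex0 mat_map_row_eq_0_iff[of "b 0" g] by (simp add: 0 b'_def D'_def)
    next
      case (Suc s')
      show ?thesis using spec[OF ex, of s'] by (simp add: Suc b'_def D'_def)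
    qed
  qed simp
  then have "koszul_vanishing i d (ideal_as_module I)" for i
    using mat_map_row_image[of "b 0" g] by (simp add: b'_def D'_def im)
  with g im[symmetric] show ?thesis by (intro exI[of _ d] exI[of _ "b 0"] exI[of _ g] conjI allI impI)
qed

lemma linear_module_has_linear_resolution:
  fixes I :: "('v::finite, 'k::field) mpoly set"
  assumes I: "linear_module d 1 (ideal_as_module I)"
  shows "has_linear_resolution I"
proof -
  define \<delta> where "\<delta> = case_nat d (\<lambda>_. 1 :: nat)"
  \<comment> \<open>A state consists of the rank of the ambient free module and the submodule still
    to be covered; one step covers it and passes to the kernel.\<close>
  define step where "step n x y D \<longleftrightarrow> homogeneous_matrix (\<delta> n) (fst x) (fst y) D \<and>
      mat_map (fst x) (fst y) D ` free_module (fst y) = snd x \<and>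
      snd y = {z \<in> free_module (fst y). mat_map (fst x) (fst y) D z = 0}"
    for n x y and D :: "nat \<Rightarrow> nat \<Rightarrow> ('v, 'k) mpoly"
  \<comment> \<open>The clause for \<open>n = 0\<close> pins the initial state, so that the chosen
    sequence really starts at the given ideal.\<close>
  define lin where "lin n x \<longleftrightarrow> linear_module (\<delta> n) (fst x) (snd x) \<and> (n = 0 \<longrightarrow> x = (1, ideal_as_module I))"
    for n and x :: "nat \<times> (nat \<Rightarrow> ('v, 'k) mpoly) set"
  have "\<exists>st. \<forall>n. lin n (st n) \<and> (\<exists>D. step n (st n) (st (Suc n)) D)"
  proof (rule dependent_nat_choice)
    show "\<exists>x. lin 0 x"
      using I by (intro exI[of _ "(1, ideal_as_module I)"]) (simp add: lin_def \<delta>_def)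
  next
    fix x n assume "lin n x"
    then obtain r D where "homogeneous_matrix (\<delta> n) (fst x) r D" "mat_map (fst x) r D ` free_module r = snd x"
      "linear_module 1 r {y \<in> free_module r. mat_map (fst x) r D y = 0}"
      unfolding lin_def using linear_module_step by blast
    then show "\<exists>y. lin (Suc n) y \<and> (\<exists>D. step n x y D)"
      by (intro exI[of _ "(r, {y \<in> free_module r. mat_map (fst x) r D y = 0})"])
        (auto simp: lin_def step_def \<delta>_def)
  qed
  then obtain st where st_lin: "\<And>n. lin n (st n)" and st_step: "\<And>n. \<exists>D. step n (st n) (st (Suc n)) D"
    by blast
  have "\<exists>D. \<forall>n. step n (st n) (st (Suc n)) (D n)"
    using st_step by (intro choice allI)
  then obtain D where "\<And>n. step n (st n) (st (Suc n)) (D n)" by blast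
  then have D: "\<And>n. homogeneous_matrix (\<delta> n) (fst (st n)) (fst (st (Suc n))) (D n)"
      "\<And>n. mat_map (fst (st n)) (fst (st (Suc n))) (D n) ` free_module (fst (st (Suc n))) = snd (st n)"
      "\<And>n. snd (st (Suc n)) = {x \<in> free_module (fst (st (Suc n))). mat_map (fst (st n)) (fst (st (Suc n))) (D n) x = 0}"
    by (simp_all add: step_def)
  have st: "st 0 = (1, ideal_as_module I)" using st_lin[of 0] by (simp add: lin_def)
  \<comment> \<open>State 0 is the ideal inside the ring, so the free modules of the resolution
    start at state 1, and the only row of \<open>D 0\<close> lists the generators.\<close>
  define b where "b i = fst (st (Suc i))" for i
  define g where "g = D 0 0"
  have row: "mat_map 1 n (D 0) = mat_map 1 n (\<lambda>_. g)" for n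
    by (simp add: mat_map_def g_def fun_eq_iff)
  have hom: "homogeneous_matrix 1 (b i) (b (Suc i)) (D (Suc i))" for i
    using D(1)[of "Suc i"] by (simp add: b_def \<delta>_def)
  have "minimal_graded_free_resolution I b (\<lambda>i _. d + i) g (\<lambda>i. D (Suc i))"
    unfolding minimal_graded_free_resolution_def graded_free_resolution_def
  proof (intro conjI allI impI ballI)
    fix j assume "j < b 0"
    then show "homogeneous (d + 0) (g j)"
      using D(1)[of 0] by (simp add: homogeneous_matrix_def st g_def b_def \<delta>_def)
  next
    fix i r c m assume "r < b i" "c < b (Suc i)" "m \<in> Poly_Mapping.keys (D (Suc i) r c)"
    then show "d + i + total_degree m = d + Suc i"
      using hom[of i] by (auto simp: homogeneous_matrix_def homogeneous_def)
  next
    have "ideal_as_module ((\<lambda>x. \<Sum>j<b 0. g j * x j) ` free_module (b 0)) = ideal_as_module I"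
      using D(2)[of 0] row by (simp add: st b_def flip: mat_map_row_image)
    then show "(\<lambda>x. \<Sum>j<b 0. g j * x j) ` free_module (b 0) = I"
      by (rule ideal_as_module_inj)
  next
    show "mat_map (b 0) (b 1) (D (Suc 0)) ` free_module (b 1) =
        {x \<in> free_module (b 0). (\<Sum>j<b 0. g j * x j) = 0}"
      using D(2)[of 1] D(3)[of 0] mat_map_row_eq_0_iff[of "b 0" g] row by (simp add: st b_def)
  next
    fix i
    show "mat_map (b (Suc i)) (b (Suc (Suc i))) (D (Suc (Suc i))) ` free_module (b (Suc (Suc i))) =
      {x \<in> free_module (b (Suc i)). mat_map (b i) (b (Suc i)) (D (Suc i)) x = (\<lambda>_. 0)}"
      using D(2)[of "Suc (Suc i)"] D(3)[of "Suc i"] by (simp add: b_def zero_fun_def)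
  next
    fix i r c assume "r < b i" "c < b (Suc i)"
    \<comment> \<open>Minimality holds because a linear form has no constant term.\<close>
    then have "homogeneous 1 (D (Suc i) r c)" using hom by (simp add: homogeneous_matrix_def)
    then show "Poly_Mapping.lookup (D (Suc i) r c) 0 = 0"
      unfolding homogeneous_iff by (metis total_degree_zero zero_neq_one)
  qed
  then show ?thesis unfolding has_linear_resolution_def by blast
qed

section \<open>Monomial ideals and cover ideals\<close>

interpretation ideal: module "(*) :: 'a::comm_ring_1 \<Rightarrow> 'a \<Rightarrow> 'a"
  by (rule module_mult)

definition monomial_ideal :: "('v \<Rightarrow>\<^sub>0 nat) set \<Rightarrow> ('v, 'k::comm_ring_1) mpoly set"
  where "monomial_ideal S = {f. Poly_Mapping.keys f \<subseteq> S}"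

definition exp_closed :: "('v \<Rightarrow>\<^sub>0 nat) set \<Rightarrow> bool"
  where "exp_closed S \<longleftrightarrow> (\<forall>u \<in> S. \<forall>m. exp_le u m \<longrightarrow> m \<in> S)"

lemma subspace_monomial_ideal:
  assumes "exp_closed S"
  shows "ideal.subspace (monomial_ideal S :: ('v::finite, 'k::comm_ring_1) mpoly set)"
  unfolding ideal.subspace_def
proof (intro conjI ballI allI)
  show "0 \<in> monomial_ideal S" by (simp add: monomial_ideal_def)
next
  fix f g :: "('v, 'k) mpoly" assume "f \<in> monomial_ideal S" "g \<in> monomial_ideal S"
  then show "f + g \<in> monomial_ideal S"
    using keys_add[of f g] by (auto simp: monomial_ideal_def)
next
  fix c f :: "('v, 'k) mpoly" assume f: "f \<in> monomial_ideal S"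
  show "c * f \<in> monomial_ideal S"
    unfolding monomial_ideal_def
  proof (intro CollectI subsetI)
    fix m assume "m \<in> Poly_Mapping.keys (c * f)"
    with keys_mult[of c f] obtain a b where ab: "m = a + b" "b \<in> Poly_Mapping.keys f" by blast
    with f have "b \<in> S" by (auto simp: monomial_ideal_def)
    with assms ab(1) exp_le_add_self(1)[of b a] show "m \<in> S" by (auto simp: exp_closed_def)
  qed
qed

lemma sum_monomials:
  "(\<Sum>m\<in>Poly_Mapping.keys f. Poly_Mapping.single m (Poly_Mapping.lookup f m)) = f"
  by (rule poly_mapping_eqI) (auto simp: lookup_sum lookup_single when_def in_keys_iff)

lemma monomial_ideal_subset_span:
  assumes "\<And>m c. m \<in> S \<Longrightarrow> Poly_Mapping.single m c \<in> ideal_gen (G :: ('v, 'k::comm_ring_1) mpoly set)"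
  shows "monomial_ideal S \<subseteq> ideal_gen G"
proof
  fix f :: "('v, 'k) mpoly" assume f: "f \<in> monomial_ideal S"
  have "(\<Sum>m\<in>Poly_Mapping.keys f. Poly_Mapping.single m (Poly_Mapping.lookup f m)) \<in> ideal_gen G"
    using f by (intro ideal.span_sum assms) (auto simp: monomial_ideal_def)
  then show "f \<in> ideal_gen G" unfolding sum_monomials .
qed

lemma single_eq_mult:
  "exp_le u m \<Longrightarrow> Poly_Mapping.single m c = Poly_Mapping.single (m - u) c * Poly_Mapping.single u (1 :: 'k::comm_ring_1)"
  by (simp add: mult_single exp_le_add_diff)

section \<open>Symbolic powers of cover ideals as monomial ideals\<close>

definition edge_exps :: "'v set \<Rightarrow> nat \<Rightarrow> ('v \<Rightarrow>\<^sub>0 nat) set"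
  where "edge_exps e k = {m. k \<le> (\<Sum>v\<in>e. Poly_Mapping.lookup m v)}"

lemma exp_closed_edge_exps: "exp_closed (edge_exps e k)"
  by (auto simp: exp_closed_def edge_exps_def exp_le_def intro: le_trans[OF _ sum_mono])

lemma edge_prime_subset: "(edge_prime e :: ('v::finite, 'k::field) mpoly set) \<subseteq> monomial_ideal (edge_exps e 1)"
  unfolding edge_prime_def
proof (rule ideal.span_minimal[OF _ subspace_monomial_ideal[OF exp_closed_edge_exps]])
  show "var ` e \<subseteq> (monomial_ideal (edge_exps e 1) :: ('v, 'k) mpoly set)"
    by (auto simp: monomial_ideal_def edge_exps_def var_def lookup_single when_def sum.delta)
qed

text \<open>Each factor from the prime contributes degree at least one in the variables of
  \<open>e\<close>; conversely, a variable of \<open>e\<close> can be split off any monomial of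
  positive degree in them.\<close>

lemma ideal_power_edge_prime:
  "ideal_power (edge_prime e :: ('v::finite, 'k::field) mpoly set) k = monomial_ideal (edge_exps e k)"
proof (induction k)
  case 0
  show ?case by (auto simp: monomial_ideal_def edge_exps_def)
next
  case (Suc k)
  let ?G = "{a * b | a b. a \<in> (edge_prime e :: ('v, 'k) mpoly set) \<and> b \<in> monomial_ideal (edge_exps e k)}"
  have "ideal_gen ?G = monomial_ideal (edge_exps e (Suc k))"
  proof
    show "ideal_gen ?G \<subseteq> monomial_ideal (edge_exps e (Suc k))"
    proof (rule ideal.span_minimal[OF _ subspace_monomial_ideal[OF exp_closed_edge_exps]], rule subsetI)
      fix f assume "f \<in> ?G"
      then obtain a b where f: "f = a * b" and a: "a \<in> edge_prime e" and b: "b \<in> monomial_ideal (edge_exps e k)"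
        by blast
      show "f \<in> monomial_ideal (edge_exps e (Suc k))"
        unfolding monomial_ideal_def
      proof (intro CollectI subsetI)
        fix m assume "m \<in> Poly_Mapping.keys f"
        with keys_mult[of a b] obtain p q where pq: "m = p + q" "p \<in> Poly_Mapping.keys a" "q \<in> Poly_Mapping.keys b"
          unfolding f by blast
        have "p \<in> edge_exps e 1" "q \<in> edge_exps e k"
          using pq a b edge_prime_subset by (auto simp: monomial_ideal_def)
        then show "m \<in> edge_exps e (Suc k)"
          by (simp add: edge_exps_def pq(1) lookup_add sum.distrib)
      qed
    qed
    show "monomial_ideal (edge_exps e (Suc k)) \<subseteq> ideal_gen ?G"
    proof (rule monomial_ideal_subset_span)
      fix m and c :: 'k assume m: "m \<in> edge_exps e (Suc k)"
      then obtain v where v: "v \<in> e" "Poly_Mapping.lookup m v > 0"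
        unfolding edge_exps_def by (metis (mono_tags, lifting) mem_Collect_eq not_gr_zero not_less_eq_eq sum.neutral zero_le)
      then have le: "exp_le (Poly_Mapping.single v 1) m"
        by (auto simp: exp_le_def lookup_single when_def)
      let ?n = "m - Poly_Mapping.single v 1"
      have "(\<Sum>w\<in>e. Poly_Mapping.lookup m w) =
          (\<Sum>w\<in>e. Poly_Mapping.lookup ?n w + Poly_Mapping.lookup (Poly_Mapping.single v 1) w)"
        by (subst exp_le_add_diff[OF le, symmetric]) (intro sum.cong refl lookup_add)
      also have "\<dots> = (\<Sum>w\<in>e. Poly_Mapping.lookup ?n w) + 1"
        using v(1) by (simp add: sum.distrib lookup_single when_def)
      finally have n: "?n \<in> edge_exps e k" using m by (simp add: edge_exps_def)
      have "Poly_Mapping.single m c = var v * Poly_Mapping.single ?n c"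
        unfolding var_def by (subst single_eq_mult[OF le]) (simp add: mult_single add.commute)
      moreover have "var v \<in> (edge_prime e :: ('v, 'k) mpoly set)"
        unfolding edge_prime_def using v(1) by (intro ideal.span_base) simp
      moreover have "Poly_Mapping.single ?n c \<in> monomial_ideal (edge_exps e k)"
        using n by (simp add: monomial_ideal_def)
      ultimately show "Poly_Mapping.single m c \<in> ideal_gen ?G"
        by (intro ideal.span_base) blast
    qed
  qed
  then show ?case by (simp add: ideal_mult_def Suc)
qed

definition cover_exps :: "'v set set \<Rightarrow> nat \<Rightarrow> ('v \<Rightarrow>\<^sub>0 nat) set"
  where "cover_exps E k = (\<Inter>e\<in>E. edge_exps e k)"

lemma exp_closed_cover_exps: "exp_closed (cover_exps E k)"
  using exp_closed_edge_exps unfolding cover_exps_def exp_closed_def by blast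

lemma cover_ideal_symbolic_power_monomial:
  "(cover_ideal_symbolic_power E k :: ('v::finite, 'k::field) mpoly set) = monomial_ideal (cover_exps E k)"
  by (auto simp: cover_ideal_symbolic_power_def ideal_power_edge_prime monomial_ideal_def cover_exps_def)

section \<open>Degree components of monomial ideals\<close>

definition degree_exps :: "('v \<Rightarrow>\<^sub>0 nat) set \<Rightarrow> nat \<Rightarrow> ('v \<Rightarrow>\<^sub>0 nat) set"
  where "degree_exps S l = {m. \<exists>u\<in>S. total_degree u = l \<and> exp_le u m}"

lemma exp_closed_degree_exps: "exp_closed (degree_exps S l)"
  unfolding exp_closed_def degree_exps_def using exp_le_trans by blast

text \<open>The terms of an element of degree \<open>l\<close> lie in the monomial ideal and have
  degree \<open>l\<close> themselves, so the monomials of degree \<open>l\<close> already generate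
  the component.\<close>

lemma degree_component_monomial_ideal:
  "degree_component_ideal (monomial_ideal S :: ('v::finite, 'k::field) mpoly set) l = monomial_ideal (degree_exps S l)"
  unfolding degree_component_ideal_def
proof
  show "ideal_gen {f \<in> monomial_ideal S. homogeneous l f} \<subseteq> (monomial_ideal (degree_exps S l) :: ('v, 'k) mpoly set)"
    by (rule ideal.span_minimal[OF _ subspace_monomial_ideal[OF exp_closed_degree_exps]])
      (auto simp: monomial_ideal_def degree_exps_def homogeneous_def)
  show "(monomial_ideal (degree_exps S l) :: ('v, 'k) mpoly set) \<subseteq> ideal_gen {f \<in> monomial_ideal S. homogeneous l f}"
  proof (rule monomial_ideal_subset_span)
    fix m and c :: 'k assume "m \<in> degree_exps S l"
    then obtain u where u: "u \<in> S" "total_degree u = l" "exp_le u m" by (auto simp: degree_exps_def)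
    have "Poly_Mapping.single u (1 :: 'k) \<in> {f \<in> monomial_ideal S. homogeneous l f}"
      using u homogeneous_single[of u] by (simp add: monomial_ideal_def)
    then show "Poly_Mapping.single m c \<in> ideal_gen {f \<in> monomial_ideal S. homogeneous l f}"
      unfolding single_eq_mult[OF u(3)] by (intro ideal.span_scale ideal.span_base)
  qed
qed

lemma ideal_as_module_monomial_ideal: "ideal_as_module (monomial_ideal S) = monomial_module 1 S"
  by (auto simp: ideal_as_module_def monomial_ideal_def monomial_module_def free_module_def)
    (metis One_nat_def Suc_leI empty_iff keys_zero neq0_conv subset_iff)

lemma koszul_vanishing_empty:
  "koszul_vanishing i d (monomial_module n {} :: (nat \<Rightarrow> ('v::finite, 'k::comm_ring_1) mpoly) set)"
proof (rule koszul_vanishing_monomialI)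
  fix b :: "'v \<Rightarrow>\<^sub>0 nat" and C :: "'v set \<Rightarrow> 'k"
  assume "C \<in> multigraded_chains i b {}" "simplicial_boundary C = 0"
  then have "C = 0" by (auto simp: multigraded_chains_def fun_eq_iff)
  then show "\<exists>W\<in>multigraded_chains (Suc i) b {}. simplicial_boundary W = C"
    by (intro bexI[of _ 0]) (auto simp: multigraded_chains_def simplicial_boundary_def fun_eq_iff)
qed

lemma koszul_vanishing_mono: "koszul_vanishing i d M \<Longrightarrow> d \<le> d' \<Longrightarrow> koszul_vanishing i d' M"
  by (simp add: koszul_vanishing_def)

lemma linear_module_monomial:
  assumes van: "\<And>i. koszul_vanishing i l (monomial_module n S :: (nat \<Rightarrow> ('v::finite, 'k::comm_ring_1) mpoly) set)"
    and S: "exp_closed S" "\<And>m. m \<in> S \<Longrightarrow> l \<le> total_degree m"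
  shows "linear_module l n (monomial_module n S :: (nat \<Rightarrow> ('v, 'k) mpoly) set)"
  unfolding linear_module_def
proof (intro conjI allI ballI impI)
  show "monomial_module n S \<subseteq> free_module n" by (auto simp: monomial_module_def)
  show "vec.subspace (monomial_module n S :: (nat \<Rightarrow> ('v, 'k) mpoly) set)"
    using subspace_monomial_ideal[OF S(1), where 'k = 'k] subspace_free_module[of n, where 'a = "('v, 'k) mpoly"]
    by (auto simp: vec.subspace_def ideal.subspace_def monomial_module_def monomial_ideal_def vec_scale_def)
  show "koszul_vanishing i l (monomial_module n S :: (nat \<Rightarrow> ('v, 'k) mpoly) set)" for i by (rule van)
next
  fix x :: "nat \<Rightarrow> ('v, 'k) mpoly" and e assume x: "x \<in> monomial_module n S"
  have keys: "Poly_Mapping.keys (hcomp e (x j)) \<subseteq> Poly_Mapping.keys (x j)" for j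
    by (auto simp: in_keys_iff lookup_hcomp split: if_splits)
  with x show "(\<lambda>j. hcomp e (x j)) \<in> monomial_module n S"
    by (fastforce simp: monomial_module_def free_module_def)
  assume "e < l"
  have "hcomp e (x j) = 0" for j
  proof (rule poly_mapping_eqI)
    fix m
    have "Poly_Mapping.keys (x j) \<subseteq> S" using x by (simp add: monomial_module_def)
    then have "m \<in> Poly_Mapping.keys (x j) \<Longrightarrow> total_degree m \<noteq> e"
      using S(2)[of m] \<open>e < l\<close> by auto
    then show "Poly_Mapping.lookup (hcomp e (x j)) m = Poly_Mapping.lookup 0 m"
      by (auto simp: lookup_hcomp in_keys_iff)
  qed
  then show "(\<lambda>j. hcomp e (x j)) = 0" by (simp add: fun_eq_iff)
qed

text \<open>A resolution yields vanishing above its own generating degree \<open>d\<close>. If the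
  component is nonzero, a monomial of degree \<open>l\<close> is a combination of generators of
  degree \<open>d\<close>, so \<open>d\<close> is at most \<open>l\<close>; a zero component has no
  homology.\<close>

lemma has_linear_resolution_monomial_iff:
  "has_linear_resolution (monomial_ideal (degree_exps S l) :: ('v::finite, 'k::field) mpoly set) \<longleftrightarrow>
    (\<forall>i. koszul_vanishing i l (monomial_module 1 (degree_exps S l) :: (nat \<Rightarrow> ('v, 'k) mpoly) set))"
    (is "?L \<longleftrightarrow> ?R")
proof
  assume ?R
  then have "linear_module l 1 (ideal_as_module (monomial_ideal (degree_exps S l) :: ('v, 'k) mpoly set))"
    unfolding ideal_as_module_monomial_ideal
    by (intro linear_module_monomial exp_closed_degree_exps) (auto simp: degree_exps_def dest: total_degree_mono)
  then show ?L by (rule linear_module_has_linear_resolution)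
next
  assume ?L
  then obtain d n and g :: "nat \<Rightarrow> ('v, 'k) mpoly" where
    van: "\<forall>i. koszul_vanishing i d (ideal_as_module (monomial_ideal (degree_exps S l)) :: (nat \<Rightarrow> ('v, 'k) mpoly) set)"
    and g: "\<forall>j<n. homogeneous d (g j)"
    and gen: "monomial_ideal (degree_exps S l) = (\<lambda>x. \<Sum>j<n. g j * x j) ` free_module n"
    by (elim exE[OF has_linear_resolution_koszul_vanishing] exE conjE)
  show ?R
  proof (cases "\<exists>u\<in>S. total_degree u = l")
    case True
    then obtain u where u: "u \<in> S" "total_degree u = l" by blast
    then have "Poly_Mapping.single u 1 \<in> (monomial_ideal (degree_exps S l) :: ('v, 'k) mpoly set)"
      by (auto simp: monomial_ideal_def degree_exps_def)
    then obtain x where x: "Poly_Mapping.single u 1 = (\<Sum>j<n. g j * x j)" unfolding gen by blast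
    have "Poly_Mapping.lookup (\<Sum>j<n. g j * x j) u \<noteq> 0" unfolding x[symmetric] by simp
    then obtain j where j: "j < n" "u \<in> Poly_Mapping.keys (g j * x j)"
      unfolding lookup_sum in_keys_iff by (meson lessThan_iff sum.neutral)
    then obtain p q where "u = p + q" "p \<in> Poly_Mapping.keys (g j)"
      using keys_mult[of "g j" "x j"] by blast
    with g j(1) u(2) have "d \<le> l" by (auto simp: homogeneous_def total_degree_add)
    with van show ?thesis unfolding ideal_as_module_monomial_ideal using koszul_vanishing_mono by blast
  next
    case False
    then have "degree_exps S l = {}" by (auto simp: degree_exps_def)
    then show ?thesis by (simp add: koszul_vanishing_empty)
  qed
qed

section \<open>Comparison of the symbolic powers for \<open>k\<close> and
  \<open>k + 2\<close>\<close>

definition exp_min :: "('v::finite \<Rightarrow>\<^sub>0 nat) \<Rightarrow> ('v \<Rightarrow> nat) \<Rightarrow> 'v \<Rightarrow>\<^sub>0 nat"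
  where "exp_min w a = Abs_poly_mapping (\<lambda>v. min (Poly_Mapping.lookup w v) (a v))"

lemma lookup_exp_min: "Poly_Mapping.lookup (exp_min w a) v = min (Poly_Mapping.lookup w v) (a v)"
  by (simp add: exp_min_def lookup_Abs_finite)

text \<open>
  The hypotheses say that \<open>T\<close> is generated by exponents below \<open>a\<close>, and that shifting by \<open>s\<close>
  identifies \<open>T\<close> below \<open>a\<close> with \<open>S\<close> below \<open>a + s\<close>.  In a multidegree below \<open>a\<close> the Koszul
  complexes of both ideals agree; in any other one, that of \<open>T\<close> is a cone over a vertex in which
  \<open>a\<close> is exceeded.
\<close>

lemma koszul_vanishing_restrict:
  fixes S T :: "('v::finite \<Rightarrow>\<^sub>0 nat) set"
  assumes T: "exp_closed T" "\<And>w. w \<in> T \<Longrightarrow> exp_min w a \<in> T"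
    and TS: "\<And>w. w \<in> T \<Longrightarrow> w + s \<in> S"
    and ST: "\<And>u. u \<in> S \<Longrightarrow> \<forall>v. Poly_Mapping.lookup u v \<le> a v + Poly_Mapping.lookup s v \<Longrightarrow>
      exp_le s u \<and> u - s \<in> T"
    and van: "koszul_vanishing i (l + total_degree s)
      (monomial_module 1 (degree_exps S (l + total_degree s)) :: (nat \<Rightarrow> ('v, 'k::comm_ring_1) mpoly) set)"
  shows "koszul_vanishing i l (monomial_module n (degree_exps T l) :: (nat \<Rightarrow> ('v, 'k) mpoly) set)"
proof (rule koszul_vanishing_monomialI)
  fix b and C :: "'v set \<Rightarrow> 'k"
  assume b: "l + i < total_degree b" and C: "C \<in> multigraded_chains i b (degree_exps T l)"
    and cyc: "simplicial_boundary C = 0"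
  show "\<exists>W\<in>multigraded_chains (Suc i) b (degree_exps T l). simplicial_boundary W = C"
  proof (cases "\<forall>v. Poly_Mapping.lookup b v \<le> a v")
    case True
    \<comment> \<open>The same coefficients form a chain for \<open>S\<close>: the sets
      \<open>A\<close> are unchanged, and their monomials are multiplied by that of
      \<open>s\<close>.\<close>
    have "C \<in> multigraded_chains i (b + s) (degree_exps S (l + total_degree s))"
      unfolding multigraded_chains_def
    proof (intro CollectI allI impI)
      fix A assume "C A \<noteq> 0"
      with C have A: "card A = i" "exp_le (indicator_exp A) b" "b - indicator_exp A \<in> degree_exps T l"
        unfolding multigraded_chains_def by blast+
      then obtain u where u: "u \<in> T" "total_degree u = l" "exp_le u (b - indicator_exp A)"
        by (auto simp: degree_exps_def)
      have "b + s - indicator_exp A = b - indicator_exp A + s"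
        using A(2) by (intro poly_mapping_eqI) (simp add: lookup_minus lookup_add exp_le_def)
      with u(3) have "exp_le (u + s) (b + s - indicator_exp A)"
        by (simp add: exp_le_def lookup_add)
      then have "b + s - indicator_exp A \<in> degree_exps S (l + total_degree s)"
        using TS[OF u(1)] u(2) by (auto simp: degree_exps_def total_degree_add intro!: bexI[of _ "u + s"])
      with A show "card A = i \<and> exp_le (indicator_exp A) (b + s) \<and>
          b + s - indicator_exp A \<in> degree_exps S (l + total_degree s)"
        using exp_le_trans[OF A(2) exp_le_add_self(2)] by blast
    qed
    moreover have "l + total_degree s + i < total_degree (b + s)"
      using b by (simp add: total_degree_add)
    ultimately obtain W where W: "W \<in> multigraded_chains (Suc i) (b + s) (degree_exps S (l + total_degree s))"
      "simplicial_boundary W = C"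
      using koszul_vanishing_monomialD[OF van _ _ cyc] by blast
    have "W \<in> multigraded_chains (Suc i) b (degree_exps T l)"
      unfolding multigraded_chains_def
    proof (intro CollectI allI impI)
      fix A assume "W A \<noteq> 0"
      with W(1) have A: "card A = Suc i" "exp_le (indicator_exp A) (b + s)"
        "b + s - indicator_exp A \<in> degree_exps S (l + total_degree s)"
        unfolding multigraded_chains_def by blast+
      then obtain u where u: "u \<in> S" "total_degree u = l + total_degree s" "exp_le u (b + s - indicator_exp A)"
        by (auto simp: degree_exps_def)
      \<comment> \<open>Stated additively to avoid truncated subtraction; together with
        \<open>b\<close> below \<open>a\<close> it puts \<open>u\<close> in the range where
        \<open>ST\<close> applies.\<close>
      have le: "Poly_Mapping.lookup u v + Poly_Mapping.lookup (indicator_exp A) v \<le>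
          Poly_Mapping.lookup b v + Poly_Mapping.lookup s v" for v
      proof -
        have "Poly_Mapping.lookup (indicator_exp A) v \<le> Poly_Mapping.lookup b v + Poly_Mapping.lookup s v"
          "Poly_Mapping.lookup u v \<le>
            Poly_Mapping.lookup b v + Poly_Mapping.lookup s v - Poly_Mapping.lookup (indicator_exp A) v"
          using A(2) u(3) unfolding exp_le_def lookup_add lookup_minus by blast+
        then show ?thesis by simp
      qed
      have "Poly_Mapping.lookup u v \<le> a v + Poly_Mapping.lookup s v" for v
        using le[of v] spec[OF True, of v] by linarith
      with ST[OF u(1)] have s: "exp_le s u" "u - s \<in> T" by blast+
      have le': "Poly_Mapping.lookup s v \<le> Poly_Mapping.lookup u v" for v
        using s(1) by (simp add: exp_le_def)
      have "exp_le (indicator_exp A) b"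
        unfolding exp_le_def
      proof
        fix v show "Poly_Mapping.lookup (indicator_exp A) v \<le> Poly_Mapping.lookup b v"
          using le[of v] le'[of v] by linarith
      qed
      moreover have "exp_le (u - s) (b - indicator_exp A)"
        unfolding exp_le_def lookup_minus
      proof
        fix v show "Poly_Mapping.lookup u v - Poly_Mapping.lookup s v \<le>
            Poly_Mapping.lookup b v - Poly_Mapping.lookup (indicator_exp A) v"
          using le[of v] le'[of v] by linarith
      qed
      moreover have "total_degree (u - s) = l"
        using u(2) by (simp add: total_degree_diff[OF s(1)])
      ultimately show "card A = Suc i \<and> exp_le (indicator_exp A) b \<and> b - indicator_exp A \<in> degree_exps T l"
        using A(1) s(2) by (auto simp: degree_exps_def)
    qed
    with W(2) show ?thesis by blast
  next
    case False
    then obtain x where x: "a x < Poly_Mapping.lookup b x" by (auto simp: not_le)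
    have "cone x C \<in> multigraded_chains (Suc i) b (degree_exps T l)"
    proof (rule multigraded_chains_cone[OF C])
      fix A assume A: "x \<notin> A" "card A = i" "exp_le (indicator_exp A) b" "b - indicator_exp A \<in> degree_exps T l"
      then obtain w where w: "w \<in> T" "total_degree w = l" "exp_le w (b - indicator_exp A)"
        by (auto simp: degree_exps_def)
      let ?m = "b - indicator_exp (insert x A)"
      have ins: "exp_le (indicator_exp (insert x A)) b"
        using A(3) x by (auto simp: exp_le_indicator_exp)
      \<comment> \<open>Capping at \<open>a\<close> leaves room at \<open>x\<close>, where
        \<open>b\<close> exceeds \<open>a\<close>, so the capped monomial still divides after
        \<open>x\<close> has been removed from the multidegree.\<close>
      have "exp_le (exp_min w a) ?m"
        unfolding exp_le_def lookup_minus lookup_exp_min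
      proof
        fix v
        have "Poly_Mapping.lookup w v \<le> Poly_Mapping.lookup b v - Poly_Mapping.lookup (indicator_exp A) v"
          using w(3) by (simp add: exp_le_def lookup_minus)
        then show "min (Poly_Mapping.lookup w v) (a v) \<le>
            Poly_Mapping.lookup b v - Poly_Mapping.lookup (indicator_exp (insert x A)) v"
          using x by (auto simp: lookup_indicator_exp split: if_splits)
      qed
      moreover have "total_degree (exp_min w a) \<le> l"
        using total_degree_mono[of "exp_min w a" w] w(2) by (simp add: exp_le_def lookup_exp_min)
      moreover have "l \<le> total_degree ?m"
        using b A(1,2) by (simp add: total_degree_diff[OF ins] total_degree_indicator_exp)
      \<comment> \<open>Capping may have lowered the degree below \<open>l\<close>, so it is raised
        back to exactly \<open>l\<close> underneath \<open>?m\<close>; the strict bound on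
        \<open>total_degree b\<close> leaves enough degree there.\<close>
      ultimately obtain w' where w': "exp_le (exp_min w a) w'" "exp_le w' ?m" "total_degree w' = l"
        by (rule exp_interpolate)
      have "w' \<in> T" using T w(1) w'(1) by (auto simp: exp_closed_def)
      with w' ins show "exp_le (indicator_exp (insert x A)) b \<and> ?m \<in> degree_exps T l"
        by (auto simp: degree_exps_def)
    qed
    with simplicial_boundary_cone[OF cyc] show ?thesis by blast
  qed
qed

text \<open>The degree \<open>l\<close> component for \<open>k\<close> is compared with the degree
  \<open>l + total_degree s\<close> component for \<open>k + 2\<close>, so linearity is passed down
  one component at a time.\<close>

lemma componentwise_linear_symbolic_power_descend:
  fixes E :: "'v::finite set set"
  assumes E: "simple_graph E"
    and lin: "componentwise_linear (cover_ideal_symbolic_power E (k + 2) :: ('v, 'k::field) mpoly set)"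
  shows "componentwise_linear (cover_ideal_symbolic_power E k :: ('v, 'k) mpoly set)"
  unfolding componentwise_linear_def cover_ideal_symbolic_power_monomial degree_component_monomial_ideal
    has_linear_resolution_monomial_iff
proof (intro allI)
  fix l i
  define s where "s = indicator_exp (\<Union>E)"
  define a where "a v = (if v \<in> \<Union>E then k else 0)" for v
  have edge: "\<exists>u v. e = {u, v} \<and> u \<noteq> v \<and> u \<in> \<Union>E \<and> v \<in> \<Union>E" if "e \<in> E" for e
  proof -
    from E that obtain u v where "u \<noteq> v" "e = {u, v}" by (auto simp: simple_graph_def)
    with that show ?thesis by blast
  qed
  show "koszul_vanishing i l (monomial_module 1 (degree_exps (cover_exps E k) l) :: (nat \<Rightarrow> ('v, 'k) mpoly) set)"
  proof (rule koszul_vanishing_restrict[where a = a and s = s and S = "cover_exps E (k + 2)"])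
    show "exp_closed (cover_exps E k)" by (rule exp_closed_cover_exps)
    \<comment> \<open>If an endpoint of an edge is capped, its exponent is already \<open>k\<close>;
      otherwise the sum over the edge is unchanged.\<close>
    show "exp_min w a \<in> cover_exps E k" if "w \<in> cover_exps E k" for w
      unfolding cover_exps_def
    proof
      fix e assume e: "e \<in> E"
      with edge obtain u v where uv: "e = {u, v}" "u \<noteq> v" "u \<in> \<Union>E" "v \<in> \<Union>E" by blast
      from that e have "w \<in> edge_exps e k" by (auto simp: cover_exps_def)
      with uv show "exp_min w a \<in> edge_exps e k"
        by (simp add: edge_exps_def lookup_exp_min a_def)
    qed
    show "w + s \<in> cover_exps E (k + 2)" if "w \<in> cover_exps E k" for w
      unfolding cover_exps_def
    proof
      fix e assume e: "e \<in> E"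
      with edge obtain u v where uv: "e = {u, v}" "u \<noteq> v" "u \<in> \<Union>E" "v \<in> \<Union>E" by blast
      from that e have "w \<in> edge_exps e k" by (auto simp: cover_exps_def)
      with uv show "w + s \<in> edge_exps e (k + 2)"
        by (simp add: edge_exps_def lookup_add s_def lookup_indicator_exp)
    qed
    show "exp_le s u \<and> u - s \<in> cover_exps E k"
      if u: "u \<in> cover_exps E (k + 2)" "\<forall>v. Poly_Mapping.lookup u v \<le> a v + Poly_Mapping.lookup s v" for u
    proof
      \<comment> \<open>Both endpoints have exponent at most \<open>k + 1\<close> while their sum is
        at least \<open>k + 2\<close>, so neither is zero. This is where the shift by two
        enters.\<close>
      have low: "Poly_Mapping.lookup u x > 0 \<and> Poly_Mapping.lookup u y > 0 \<and>
          k + 2 \<le> Poly_Mapping.lookup u x + Poly_Mapping.lookup u y"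
        if "e \<in> E" "e = {x, y}" "x \<noteq> y" for e x y
      proof -
        have "Poly_Mapping.lookup u x \<le> k + 1" "Poly_Mapping.lookup u y \<le> k + 1"
          using spec[OF u(2), of x] spec[OF u(2), of y] that
          by (auto simp: a_def s_def lookup_indicator_exp split: if_splits)
        moreover have "k + 2 \<le> Poly_Mapping.lookup u x + Poly_Mapping.lookup u y"
          using u(1) that by (auto simp: cover_exps_def edge_exps_def)
        ultimately show ?thesis by linarith
      qed
      show "exp_le s u"
        unfolding s_def exp_le_indicator_exp
      proof
        fix v assume "v \<in> \<Union>E"
        then obtain e where "e \<in> E" "v \<in> e" by blast
        with edge low show "Poly_Mapping.lookup u v > 0" by blast
      qed
      show "u - s \<in> cover_exps E k"
        unfolding cover_exps_def
      proof
        fix e assume e: "e \<in> E"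
        with edge obtain x y where xy: "e = {x, y}" "x \<noteq> y" "x \<in> \<Union>E" "y \<in> \<Union>E" by blast
        with low[OF e xy(1,2)] show "u - s \<in> edge_exps e k"
          by (simp add: edge_exps_def lookup_minus s_def lookup_indicator_exp) arith
      qed
    qed
    show "koszul_vanishing i (l + total_degree s)
      (monomial_module 1 (degree_exps (cover_exps E (k + 2)) (l + total_degree s)) :: (nat \<Rightarrow> ('v, 'k) mpoly) set)"
      using lin unfolding componentwise_linear_def cover_ideal_symbolic_power_monomial
        degree_component_monomial_ideal has_linear_resolution_monomial_iff by blast
  qed
qed

theorem theorem3p2:
  fixes E :: "'v::finite set set" and k k' :: nat
  assumes "simple_graph E"
    and "k \<ge> 1"
    and "\<not> componentwise_linear (cover_ideal_symbolic_power E k :: ('v, 'k::field) mpoly set)"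
    and "\<not> componentwise_linear (cover_ideal_symbolic_power E (k + 1) :: ('v, 'k) mpoly set)"
    and "k' \<ge> k"
  shows "\<not> componentwise_linear (cover_ideal_symbolic_power E k' :: ('v, 'k) mpoly set)"
  using assms(5)
proof (induction k' rule: less_induct)
  case (less k')
  \<comment> \<open>The contrapositive of the descent carries failure from \<open>k' - 2\<close> to
    \<open>k'\<close>; the two consecutive failures are the base cases of the two parities.\<close>
  consider "k' = k" | "k' = k + 1" | "k \<le> k' - 2" "k' - 2 < k'" "k' = k' - 2 + 2"
    using less.prems by linarith
  then show ?case
  proof cases
    case 3
    then show ?thesis
      using less.IH componentwise_linear_symbolic_power_descend[OF assms(1)] by metis
  qed (use assms(3,4) in simp_all)
qed

end
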